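(* Let $n\ge 1$ and let $\{W,V_1,\dots,V_n\}$ be an isometric Nica-covariant representation of the odometer semigroup $\mathbb{O}_n$ on a Hilbert space $\mathcal{H}$. Then $\mathcal{H}$ decomposes uniquely as an orthogonal direct sum $$\mathcal{H}=\mathcal{H}_{uu}\oplus\mathcal{H}_{us}\oplus\mathcal{H}_{su}\oplus\mathcal{H}_{ss},$$ where: (1) the subspaces $\mathcal{H}_{uu},\mathcal{H}_{us},\mathcal{H}_{su},\mathcal{H}_{ss}$ are reducing for $W$ and for every $V_i$; (2) $W|_{\mathcal{H}_{uu}}$ is unitary and $\{V_1,\dots,V_n\}|_{\mathcal{H}_{uu}}$ is a row unitary; (3) $W|_{\mathcal{H}_{us}}$ is unitary and $\{V_1,\dots,V_n\}|_{\mathcal{H}_{us}}$ is a pure row isometry; (4) $W|_{\mathcal{H}_{su}}$ is a pure isometry and $\{V_1,\dots,V_n\}|_{\mathcal{H}_{su}}$ is a row unitary; (5) the family $\{W,V_1,\dots,V_n\}|_{\mathcal{H}_{ss}}$ is unitarily equivalent to a direct sum of copies of the left regular representation of $\mathbb{O}_n$.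
   Context: A (closed) subspace reduces an operator $T$ if it is invariant for $T$ and $T^*$. An isometry $V$ on $\mathcal{H}$ is pure if $\bigcap_{m\ge 0}V^m\mathcal{H}=\{0\}$ (equivalently, it is a direct sum of unilateral shifts). A row isometry is a family $\{V_1,\dots,V_n\}$ of isometries on $\mathcal{H}$ with pairwise orthogonal ranges; it is a row unitary if $\sum_k V_kV_k^*=I$. $\mathbb{F}_n^+$ is the free semigroup (with empty word) on $\{1,\dots,n\}$, and for $\mu=\mu_1\cdots\mu_m\in\mathbb{F}_n^+$, $V_\mu=V_{\mu_1}\cdots V_{\mu_m}$, $|\mu|=m$. A row isometry is pure if $\bigcap_{m\ge 0}\bigoplus_{|\mu|=m}V_\mu\mathcal{H}=\{0\}$ (equivalently, it is a direct sum of copies of the left regular representation of $\mathbb{F}_n^+$). Summands in a decomposition may be $\{0\}$. The odometer semigroup $\mathbb{O}_n$ is the unital semigroup generated by $v_1,\dots,v_n,w$, where $v_1,\dots,v_n$ are free generators, subject to $wv_k=v_{k+1}$ for $1\le k\le n-1$ and $wv_n=v_1w$; every element has a unique form $v_\mu w^N$ with $\mu\in\mathbb{F}_n^+$, $N\ge 0$. Its left regular representation acts on $\ell^2(\mathbb{O}_n)$ with orthonormal basis $\{e_x:x\in\mathbb{O}_n\}$ by $We_x=e_{wx}$, $V_ie_x=e_{v_ix}$. An isometric representation of $\mathbb{O}_n$ on $\mathcal{H}$ is a collection $\{W,V_1,\dots,V_n\}$ consisting of an isometry $W$ and a row isometry $\{V_1,\dots,V_n\}$ on $\mathcal{H}$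 such that $WV_k=V_{k+1}$ for $1\le k\le n-1$ and $WV_n=V_1W$. It is Nica-covariant if $W^*V_1=V_nW^*$. *)

theory Defs
  imports "HOL-Analysis.Analysis" "HOL-Algebra.Group"
begin

section \<open>Complex Hilbert spaces\<close>

text \<open>
  A complex Hilbert space is presented as its underlying real Hilbert space (which supplies the
  library's norm and topology) together with a complex scalar multiplication and a complex inner
  product whose real part is the real inner product. The complex inner product is conjugate-linear
  in its first argument. The zero space is an admissible instance.
\<close>

class chilbert_space = real_inner + complete_space +
  fixes scaleC :: "complex \<Rightarrow> 'a \<Rightarrow> 'a" (infixr "*\<^sub>C" 75)
    and cinner :: "'a \<Rightarrow> 'a \<Rightarrow> complex"
  assumes scaleC_add_right: "c *\<^sub>C (x + y) = c *\<^sub>C x + c *\<^sub>C y"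
    and scaleC_add_left: "(c + d) *\<^sub>C x = c *\<^sub>C x + d *\<^sub>C x"
    and scaleC_scaleC: "c *\<^sub>C d *\<^sub>C x = (c * d) *\<^sub>C x"
    and scaleC_of_real: "complex_of_real r *\<^sub>C x = r *\<^sub>R x"
    and cinner_commute: "cinner x y = cnj (cinner y x)"
    and cinner_add_right: "cinner x (y + z) = cinner x y + cinner x z"
    and cinner_scaleC_right: "cinner x (c *\<^sub>C y) = c * cinner x y"
    and Re_cinner: "Re (cinner x y) = inner x y"

definition closed_csubspace :: "'a::chilbert_space set \<Rightarrow> bool" where
  "closed_csubspace M \<longleftrightarrow> closed M \<and> 0 \<in> M \<and>
     (\<forall>x\<in>M. \<forall>y\<in>M. x + y \<in> M) \<and> (\<forall>c. \<forall>x\<in>M. c *\<^sub>C x \<in> M)"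

text \<open>
  Properties of an operator restricted to a subspace \<open>M\<close> are stated relative to \<open>M\<close>; those of an
  operator on the whole space are obtained with \<open>M = UNIV\<close>.
\<close>

definition clinear_on :: "'a::chilbert_space set \<Rightarrow> ('a \<Rightarrow> 'a) \<Rightarrow> bool" where
  "clinear_on M T \<longleftrightarrow> (\<forall>x\<in>M. T x \<in> M) \<and> (\<forall>x\<in>M. \<forall>y\<in>M. T (x + y) = T x + T y) \<and>
     (\<forall>c. \<forall>x\<in>M. T (c *\<^sub>C x) = c *\<^sub>C T x)"

text \<open>
  The Hilbert space adjoint of the restriction of \<open>T\<close> to \<open>M\<close>. By the Riesz representation theorem,
  the described vector exists (and is unique) if \<open>M\<close> is a closed subspace and \<open>T\<close> is bounded and
  linear on \<open>M\<close>.
\<close>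

definition adjoint_on :: "'a::chilbert_space set \<Rightarrow> ('a \<Rightarrow> 'a) \<Rightarrow> 'a \<Rightarrow> 'a" where
  "adjoint_on M T y = (THE z. z \<in> M \<and> (\<forall>x\<in>M. cinner (T x) y = cinner x z))"

definition reduces :: "'a::chilbert_space set \<Rightarrow> ('a \<Rightarrow> 'a) \<Rightarrow> bool" where
  "reduces M T \<longleftrightarrow> closed_csubspace M \<and> (\<forall>x\<in>M. T x \<in> M) \<and> (\<forall>x\<in>M. adjoint_on UNIV T x \<in> M)"

definition isometry_on :: "'a::chilbert_space set \<Rightarrow> ('a \<Rightarrow> 'a) \<Rightarrow> bool" where
  "isometry_on M T \<longleftrightarrow> clinear_on M T \<and> (\<forall>x\<in>M. norm (T x) = norm x)"

definition unitary_on :: "'a::chilbert_space set \<Rightarrow> ('a \<Rightarrow> 'a) \<Rightarrow> bool" where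
  "unitary_on M T \<longleftrightarrow> isometry_on M T \<and> T ` M = M"

definition pure_isometry_on :: "'a::chilbert_space set \<Rightarrow> ('a \<Rightarrow> 'a) \<Rightarrow> bool" where
  "pure_isometry_on M T \<longleftrightarrow> isometry_on M T \<and> (\<Inter>m. (T ^^ m) ` M) = {0}"

section \<open>Row isometries\<close>

text \<open>A family \<open>V\<^sub>1, \<dots>, V\<^sub>n\<close> is a function on \<^typ>\<open>nat\<close> whose values outside \<open>{1..n}\<close> are irrelevant.\<close>

definition row_isometry_on ::
    "'a::chilbert_space set \<Rightarrow> nat \<Rightarrow> (nat \<Rightarrow> 'a \<Rightarrow> 'a) \<Rightarrow> bool" where
  "row_isometry_on M n V \<longleftrightarrow> (\<forall>k\<in>{1..n}. isometry_on M (V k)) \<and>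
     (\<forall>j\<in>{1..n}. \<forall>k\<in>{1..n}. j \<noteq> k \<longrightarrow> (\<forall>x\<in>M. \<forall>y\<in>M. cinner (V j x) (V k y) = 0))"

definition row_unitary_on ::
    "'a::chilbert_space set \<Rightarrow> nat \<Rightarrow> (nat \<Rightarrow> 'a \<Rightarrow> 'a) \<Rightarrow> bool" where
  "row_unitary_on M n V \<longleftrightarrow> row_isometry_on M n V \<and>
     (\<forall>x\<in>M. (\<Sum>k=1..n. V k (adjoint_on M (V k) x)) = x)"

definition free_words :: "nat \<Rightarrow> nat \<Rightarrow> nat list set" where
  "free_words n m = {\<mu>. set \<mu> \<subseteq> {1..n} \<and> length \<mu> = m}"

text \<open>
  For \<open>\<mu> = \<mu>\<^sub>1\<dots>\<mu>\<^sub>m\<close>, the term \<^term>\<open>foldr V \<mu>\<close> is \<open>V\<^sub>\<mu> = V\<^bsub>\<mu>\<^sub>1\<^esub> \<dots> V\<^bsub>\<mu>\<^sub>m\<^esub>\<close>. For a row isometry the ranges of the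
  \<open>V\<^sub>\<mu>\<close> with \<open>|\<mu>| = m\<close> are closed and pairwise orthogonal, and there are finitely many of them, so
  their orthogonal direct sum is the set of finite sums below.
\<close>

definition row_range ::
    "'a::chilbert_space set \<Rightarrow> nat \<Rightarrow> (nat \<Rightarrow> 'a \<Rightarrow> 'a) \<Rightarrow> nat \<Rightarrow> 'a set" where
  "row_range M n V m =
     {\<Sum>\<mu>\<in>free_words n m. foldr V \<mu> (x \<mu>) | x. \<forall>\<mu>\<in>free_words n m. x \<mu> \<in> M}"

definition pure_row_isometry_on ::
    "'a::chilbert_space set \<Rightarrow> nat \<Rightarrow> (nat \<Rightarrow> 'a \<Rightarrow> 'a) \<Rightarrow> bool" where
  "pure_row_isometry_on M n V \<longleftrightarrow> row_isometry_on M n V \<and> (\<Inter>m. row_range M n V m) = {0}"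

section \<open>The odometer semigroup\<close>

datatype odo_gen = GenV nat | GenW

definition odo_words :: "nat \<Rightarrow> odo_gen list set" where
  "odo_words n = lists (insert GenW (GenV ` {1..n}))"

inductive odo_cong :: "nat \<Rightarrow> odo_gen list \<Rightarrow> odo_gen list \<Rightarrow> bool" for n :: nat where
  rel_step: "1 \<le> k \<Longrightarrow> k + 1 \<le> n \<Longrightarrow> odo_cong n [GenW, GenV k] [GenV (k + 1)]"
| rel_carry: "odo_cong n [GenW, GenV n] [GenV 1, GenW]"
| refl: "odo_cong n x x"
| sym: "odo_cong n x y \<Longrightarrow> odo_cong n y x"
| trans: "odo_cong n x y \<Longrightarrow> odo_cong n y z \<Longrightarrow> odo_cong n x z"
| in_context: "odo_cong n x y \<Longrightarrow> odo_cong n (u @ x @ v) (u @ y @ v)"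

definition odo_class :: "nat \<Rightarrow> odo_gen list \<Rightarrow> odo_gen list set" where
  "odo_class n x = {y \<in> odo_words n. odo_cong n x y}"

definition odometer :: "nat \<Rightarrow> odo_gen list set monoid" where
  "odometer n = \<lparr>carrier = odo_class n ` odo_words n,
     monoid.mult = (\<lambda>X Y. \<Union>x\<in>X. \<Union>y\<in>Y. odo_class n (x @ y)),
     one = odo_class n []\<rparr>"

definition odo_v :: "nat \<Rightarrow> nat \<Rightarrow> odo_gen list set" where
  "odo_v n k = odo_class n [GenV k]"

definition odo_w :: "nat \<Rightarrow> odo_gen list set" where
  "odo_w n = odo_class n [GenW]"

lemma odo_words_append: "x \<in> odo_words n \<Longrightarrow> y \<in> odo_words n \<Longrightarrow> x @ y \<in> odo_words n"
  by (auto simp: odo_words_def)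

lemma odo_class_eq: "odo_cong n x y \<Longrightarrow> odo_class n x = odo_class n y"
  unfolding odo_class_def by (blast intro: odo_cong.sym odo_cong.trans)

lemma odo_cong_append:
  assumes "odo_cong n x x'" "odo_cong n y y'"
  shows "odo_cong n (x @ y) (x' @ y')"
  using odo_cong.in_context[OF assms(1), of "[]" y] odo_cong.in_context[OF assms(2), of x' "[]"]
  by (auto intro: odo_cong.trans)

lemma odo_mult_class:
  assumes "x \<in> odo_words n" "y \<in> odo_words n"
  shows "odo_class n x \<otimes>\<^bsub>odometer n\<^esub> odo_class n y = odo_class n (x @ y)"
proof -
  have eq: "odo_class n (x' @ y') = odo_class n (x @ y)"
    if "x' \<in> odo_class n x" "y' \<in> odo_class n y" for x' y'
  proof (rule odo_class_eq, rule odo_cong.sym, rule odo_cong_append)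
    show "odo_cong n x x'" "odo_cong n y y'" using that by (simp_all add: odo_class_def)
  qed
  have mem: "x \<in> odo_class n x" "y \<in> odo_class n y"
    using assms by (simp_all add: odo_class_def odo_cong.refl)
  have "odo_class n x \<otimes>\<^bsub>odometer n\<^esub> odo_class n y =
      (\<Union>x'\<in>odo_class n x. \<Union>y'\<in>odo_class n y. odo_class n (x' @ y'))"
    by (simp add: odometer_def)
  also have "\<dots> = (\<Union>x'\<in>odo_class n x. \<Union>y'\<in>odo_class n y. odo_class n (x @ y))"
    by (intro SUP_cong HOL.refl eq)
  also have "\<dots> = odo_class n (x @ y)"
    using mem by blast
  finally show ?thesis .
qed

lemma odometer_monoid: "monoid (odometer n)"
proof
  have carr: "carrier (odometer n) = odo_class n ` odo_words n"
    and one: "\<one>\<^bsub>odometer n\<^esub> = odo_class n []" by (simp_all add: odometer_def)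
  have nil: "[] \<in> odo_words n" by (simp add: odo_words_def)
  show "\<one>\<^bsub>odometer n\<^esub> \<in> carrier (odometer n)" using nil by (simp add: carr one)
  fix X Y Z
  assume "X \<in> carrier (odometer n)"
  then obtain x where x: "X = odo_class n x" "x \<in> odo_words n" by (auto simp: carr)
  show "\<one>\<^bsub>odometer n\<^esub> \<otimes>\<^bsub>odometer n\<^esub> X = X" "X \<otimes>\<^bsub>odometer n\<^esub> \<one>\<^bsub>odometer n\<^esub> = X"
    using x nil by (simp_all add: one odo_mult_class)
  assume "Y \<in> carrier (odometer n)"
  then obtain y where y: "Y = odo_class n y" "y \<in> odo_words n" by (auto simp: carr)
  show "X \<otimes>\<^bsub>odometer n\<^esub> Y \<in> carrier (odometer n)"
    using x y by (simp add: carr odo_mult_class odo_words_append)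
  assume "Z \<in> carrier (odometer n)"
  then obtain z where z: "Z = odo_class n z" "z \<in> odo_words n" by (auto simp: carr)
  show "X \<otimes>\<^bsub>odometer n\<^esub> Y \<otimes>\<^bsub>odometer n\<^esub> Z = X \<otimes>\<^bsub>odometer n\<^esub> (Y \<otimes>\<^bsub>odometer n\<^esub> Z)"
    using x y z by (simp add: odo_mult_class odo_words_append)
qed

lemma odometer_relations:
  shows "1 \<le> k \<Longrightarrow> k < n \<Longrightarrow> odo_w n \<otimes>\<^bsub>odometer n\<^esub> odo_v n k = odo_v n (k + 1)"
    and "1 \<le> n \<Longrightarrow> odo_w n \<otimes>\<^bsub>odometer n\<^esub> odo_v n n = odo_v n 1 \<otimes>\<^bsub>odometer n\<^esub> odo_w n"
proof -
  have W: "[GenW] \<in> odo_words n" by (simp add: odo_words_def)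
  have V: "[GenV k] \<in> odo_words n" if "1 \<le> k" "k \<le> n" for k
    using that by (simp add: odo_words_def)
  show "odo_w n \<otimes>\<^bsub>odometer n\<^esub> odo_v n k = odo_v n (k + 1)" if "1 \<le> k" "k < n"
    using that odo_class_eq[OF odo_cong.rel_step[of k n]]
    by (simp add: odo_w_def odo_v_def odo_mult_class W V)
  show "odo_w n \<otimes>\<^bsub>odometer n\<^esub> odo_v n n = odo_v n 1 \<otimes>\<^bsub>odometer n\<^esub> odo_w n" if "1 \<le> n"
    using that odo_class_eq[OF odo_cong.rel_carry[of n]]
    by (simp add: odo_w_def odo_v_def odo_mult_class W V)
qed

section \<open>The left regular representation and its multiples\<close>

definition ell2 :: "'x set \<Rightarrow> ('x \<Rightarrow> complex) set" where
  "ell2 X = {f. (\<forall>x. x \<notin> X \<longrightarrow> f x = 0) \<and> (\<lambda>x. (cmod (f x))\<^sup>2) summable_on X}"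

definition ell2_cinner :: "'x set \<Rightarrow> ('x \<Rightarrow> complex) \<Rightarrow> ('x \<Rightarrow> complex) \<Rightarrow> complex" where
  "ell2_cinner X f g = (\<Sum>\<^sub>\<infinity>x\<in>X. cnj (f x) * g x)"

definition ell2_basis :: "'x \<Rightarrow> 'x \<Rightarrow> complex" where
  "ell2_basis x = (\<lambda>y. if y = x then 1 else 0)"

text \<open>
  The operator \<open>e\<^sub>x \<mapsto> e\<^bsub>gx\<^esub>\<close> on \<open>\<ell>\<^sup>2\<close> of the monoid: the coefficient of the image at \<open>y\<close> collects
  the coefficients at all \<open>x\<close> with \<open>gx = y\<close> (at most one \<open>x\<close>, by left cancellation in the odometer
  semigroup).
\<close>

definition left_regular ::
    "('x, 'b) monoid_scheme \<Rightarrow> 'x \<Rightarrow> ('x \<Rightarrow> complex) \<Rightarrow> 'x \<Rightarrow> complex" where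
  "left_regular G g f = (\<lambda>y. \<Sum>\<^sub>\<infinity>x\<in>{x \<in> carrier G. g \<otimes>\<^bsub>G\<^esub> x = y}. f x)"

lemma left_regular_basis:
  assumes "x \<in> carrier G"
  shows "left_regular G g (ell2_basis x) = ell2_basis (g \<otimes>\<^bsub>G\<^esub> x)"
proof
  fix y
  let ?A = "{x \<in> carrier G. g \<otimes>\<^bsub>G\<^esub> x = y}"
  have "infsum (ell2_basis x) ?A = infsum (ell2_basis x) (?A \<inter> {x})"
    by (rule infsum_cong_neutral) (auto simp: ell2_basis_def)
  also have "\<dots> = ell2_basis (g \<otimes>\<^bsub>G\<^esub> x) y"
    using assms by (cases "g \<otimes>\<^bsub>G\<^esub> x = y") (auto simp: ell2_basis_def)
  finally show "left_regular G g (ell2_basis x) y = ell2_basis (g \<otimes>\<^bsub>G\<^esub> x) y"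
    by (simp add: left_regular_def)
qed

text \<open>The Hilbert space direct sum of copies of \<open>\<ell>\<^sup>2(X)\<close> indexed by \<open>J\<close>.\<close>

definition ell2_copies :: "'j set \<Rightarrow> 'x set \<Rightarrow> ('j \<Rightarrow> 'x \<Rightarrow> complex) set" where
  "ell2_copies J X = {F. (\<forall>j\<in>J. F j \<in> ell2 X) \<and> (\<forall>j. j \<notin> J \<longrightarrow> F j = (\<lambda>x. 0)) \<and>
     (\<lambda>j. \<Sum>\<^sub>\<infinity>x\<in>X. (cmod (F j x))\<^sup>2) summable_on J}"

definition ell2_copies_cinner ::
    "'j set \<Rightarrow> 'x set \<Rightarrow> ('j \<Rightarrow> 'x \<Rightarrow> complex) \<Rightarrow> ('j \<Rightarrow> 'x \<Rightarrow> complex) \<Rightarrow> complex" where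
  "ell2_copies_cinner J X F G = (\<Sum>\<^sub>\<infinity>j\<in>J. ell2_cinner X (F j) (G j))"

definition unitary_onto_copies ::
    "'a::chilbert_space set \<Rightarrow> 'j set \<Rightarrow> 'x set \<Rightarrow> ('a \<Rightarrow> 'j \<Rightarrow> 'x \<Rightarrow> complex) \<Rightarrow> bool" where
  "unitary_onto_copies M J X U \<longleftrightarrow> bij_betw U M (ell2_copies J X) \<and>
     (\<forall>h\<in>M. \<forall>k\<in>M. U (h + k) = (\<lambda>j x. U h j x + U k j x)) \<and>
     (\<forall>c. \<forall>h\<in>M. U (c *\<^sub>C h) = (\<lambda>j x. c * U h j x)) \<and>
     (\<forall>h\<in>M. \<forall>k\<in>M. ell2_copies_cinner J X (U h) (U k) = cinner h k)"

text \<open>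
  Unitary equivalence of the family restricted to \<open>M\<close> with a direct sum of copies of the left
  regular representation, given by a unitary \<open>U\<close> that intertwines the two families. Taking the index
  set of the copies inside the type of vectors is no restriction: the number of copies is at most
  the cardinality of an orthonormal subset of \<open>M\<close>. The index set may be empty (\<open>M = {0}\<close>).
\<close>

definition multiple_of_left_regular ::
    "'a::chilbert_space set \<Rightarrow> nat \<Rightarrow> ('a \<Rightarrow> 'a) \<Rightarrow> (nat \<Rightarrow> 'a \<Rightarrow> 'a) \<Rightarrow> bool" where
  "multiple_of_left_regular M n W V \<longleftrightarrow>
     (\<exists>(J :: 'a set) U. unitary_onto_copies M J (carrier (odometer n)) U \<and>
        (\<forall>h\<in>M. W h \<in> M \<and> U (W h) = (\<lambda>j. left_regular (odometer n) (odo_w n) (U h j))) \<and>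
        (\<forall>k\<in>{1..n}. \<forall>h\<in>M.
           V k h \<in> M \<and> U (V k h) = (\<lambda>j. left_regular (odometer n) (odo_v n k) (U h j))))"

section \<open>Representations of the odometer semigroup\<close>

definition odometer_isometric_rep ::
    "nat \<Rightarrow> ('a::chilbert_space \<Rightarrow> 'a) \<Rightarrow> (nat \<Rightarrow> 'a \<Rightarrow> 'a) \<Rightarrow> bool" where
  "odometer_isometric_rep n W V \<longleftrightarrow> isometry_on UNIV W \<and> row_isometry_on UNIV n V \<and>
     (\<forall>k. 1 \<le> k \<and> k + 1 \<le> n \<longrightarrow> W \<circ> V k = V (k + 1)) \<and> W \<circ> V n = V 1 \<circ> W"

definition nica_covariant ::
    "nat \<Rightarrow> ('a::chilbert_space \<Rightarrow> 'a) \<Rightarrow> (nat \<Rightarrow> 'a \<Rightarrow> 'a) \<Rightarrow> bool" where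
  "nica_covariant n W V \<longleftrightarrow> adjoint_on UNIV W \<circ> V 1 = V n \<circ> adjoint_on UNIV W"

definition orthogonal_decomposition ::
    "'a::chilbert_space set \<Rightarrow> 'a set \<Rightarrow> 'a set \<Rightarrow> 'a set \<Rightarrow> bool" where
  "orthogonal_decomposition A B C D \<longleftrightarrow>
     closed_csubspace A \<and> closed_csubspace B \<and> closed_csubspace C \<and> closed_csubspace D \<and>
     (\<forall>a\<in>A. \<forall>b\<in>B. \<forall>c\<in>C. \<forall>d\<in>D. cinner a b = 0 \<and> cinner a c = 0 \<and> cinner a d = 0 \<and>
        cinner b c = 0 \<and> cinner b d = 0 \<and> cinner c d = 0) \<and>
     (\<forall>h. \<exists>a\<in>A. \<exists>b\<in>B. \<exists>c\<in>C. \<exists>d\<in>D. h = a + b + c + d)"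

end

theory Submission
  imports Defs
begin

text \<open>
  Put \<open>\<C>\<^sub>W = \<Inter>\<^sub>m W\<^sup>m \<H>\<close> and \<open>\<C>\<^sub>V = \<Inter>\<^sub>m \<Oplus>\<^bsub>|\<mu>|=m\<^esub> V\<^sub>\<mu> \<H>\<close>. Nica covariance makes both of them reducing for \<open>W\<close> and
  every \<open>V\<^sub>i\<close>, so their projections commute, and the four summands are the intersections of
  \<open>\<C>\<^sub>W\<close> or its complement with \<open>\<C>\<^sub>V\<close> or its complement. On a reducing subspace \<open>M\<close> the family \<open>V\<close> is
  row unitary iff \<open>M \<subseteq> \<C>\<^sub>V\<close> and pure iff \<open>M \<bottom> \<C>\<^sub>V\<close>, and similarly for \<open>W\<close>; as the left regular
  representation is pure in both senses, any other decomposition has its summands contained in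
  these four, which gives uniqueness.

  On \<open>\<C>\<^sub>W\<^sup>\<bottom> \<inter> \<C>\<^sub>V\<^sup>\<bottom>\<close> take a maximal orthonormal family \<open>J\<close> of vectors killed by \<open>W\<^sup>*\<close> and all
  \<open>V\<^sub>i\<^sup>*\<close>. The vectors \<open>V\<^sub>\<mu> W\<^sup>N j\<close> form an orthonormal basis indexed by \<open>J\<close> and the semigroup, and the
  coordinates with respect to it intertwine the representation with copies of the left regular one.
\<close>

section \<open>Complex inner products and orthonormal families\<close>

lemma cinner_add_left: "cinner (x + y) z = cinner x z + cinner y (z :: 'a::chilbert_space)"
  by (metis cinner_commute cinner_add_right complex_cnj_add)

lemma cinner_scaleC_left: "cinner (c *\<^sub>C x) y = cnj c * cinner x (y :: 'a::chilbert_space)"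
  by (metis cinner_commute cinner_scaleC_right complex_cnj_mult)

lemma scaleC_one [simp]: "1 *\<^sub>C x = (x :: 'a::chilbert_space)"
  using scaleC_of_real[of 1 x] by simp

lemma scaleC_minus_one: "(- 1) *\<^sub>C x = - (x :: 'a::chilbert_space)"
  using scaleC_of_real[of "- 1" x] by simp

lemma scaleC_zero_left [simp]: "0 *\<^sub>C x = (0 :: 'a::chilbert_space)"
  using scaleC_of_real[of 0 x] by simp

lemma scaleC_zero_right [simp]: "c *\<^sub>C 0 = (0 :: 'a::chilbert_space)"
  by (metis add_cancel_left_left scaleC_add_right)

lemma scaleC_minus_right: "c *\<^sub>C (- x) = - (c *\<^sub>C (x :: 'a::chilbert_space))"
  by (metis scaleC_minus_one scaleC_scaleC mult.commute)

lemma cinner_minus_right [simp]: "cinner x (- y) = - cinner x (y :: 'a::chilbert_space)"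
  by (metis scaleC_minus_one cinner_scaleC_right mult_minus1)

lemma cinner_minus_left [simp]: "cinner (- x) y = - cinner x (y :: 'a::chilbert_space)"
  by (metis cinner_commute cinner_minus_right complex_cnj_minus)

lemma cinner_diff_right: "cinner x (y - z) = cinner x y - cinner x (z :: 'a::chilbert_space)"
  by (metis cinner_add_right cinner_minus_right diff_conv_add_uminus)

lemma cinner_diff_left: "cinner (x - y) z = cinner x z - cinner y (z :: 'a::chilbert_space)"
  by (metis cinner_add_left cinner_minus_left diff_conv_add_uminus)

lemma cinner_zero_right [simp]: "cinner x 0 = (0 :: complex)"
  using cinner_diff_right[of x 0 0] by simp

lemma cinner_zero_left [simp]: "cinner 0 x = (0 :: complex)"
  using cinner_diff_left[of 0 0 x] by simp

lemma cinner_sum_right: "cinner x (\<Sum>i\<in>F. f i) = (\<Sum>i\<in>F. cinner x (f i :: 'a::chilbert_space))"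
  by (induction F rule: infinite_finite_induct) (simp_all add: cinner_add_right)

lemma cinner_sum_left: "cinner (\<Sum>i\<in>F. f i) x = (\<Sum>i\<in>F. cinner (f i :: 'a::chilbert_space) x)"
  by (induction F rule: infinite_finite_induct) (simp_all add: cinner_add_left)

text \<open>The imaginary part of z is minus the real part of i z, so the real inner product
  determines the complex one.\<close>

lemma cinner_eq_Complex: "cinner x y = Complex (inner x y) (- inner x (\<i> *\<^sub>C (y :: 'a::chilbert_space)))"
  using Re_cinner[of x "\<i> *\<^sub>C y"] by (simp add: complex_eq_iff Re_cinner cinner_scaleC_right)

lemma cinner_self: "cinner x x = of_real ((norm (x :: 'a::chilbert_space))\<^sup>2)"
proof -
  have "Im (cinner x x) = 0"
    using arg_cong[OF cinner_commute[of x x], of Im] by simp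
  then show ?thesis
    by (simp add: complex_eq_iff Re_cinner dot_square_norm)
qed

lemma cinner_self_eq_0_iff [simp]: "cinner x x = 0 \<longleftrightarrow> (x :: 'a::chilbert_space) = 0"
  by (simp add: cinner_self)

lemma cinner_eq_0_commute: "cinner x y = 0 \<longleftrightarrow> cinner y (x :: 'a::chilbert_space) = 0"
  by (metis cinner_commute complex_cnj_zero)

lemma cinner_ext:
  assumes "\<And>z. cinner z x = cinner z (y :: 'a::chilbert_space)"
  shows "x = y"
proof -
  have "cinner (x - y) (x - y) = 0"
    using assms[of "x - y"] by (simp add: cinner_diff_right)
  then show ?thesis
    by simp
qed

lemma norm_scaleC: "norm (c *\<^sub>C (x :: 'a::chilbert_space)) = cmod c * norm x"
proof -
  have "complex_of_real ((norm (c *\<^sub>C x))\<^sup>2) = of_real ((cmod c * norm x)\<^sup>2)"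
    by (simp add: cinner_self[symmetric] cinner_scaleC_left cinner_scaleC_right
        complex_norm_square power_mult_distrib flip: mult.assoc of_real_power)
  then show ?thesis
    by (metis of_real_eq_iff norm_ge_zero mult_nonneg_nonneg power2_eq_imp_eq)
qed

text \<open>Multiplying \<open>y\<close> by the unimodular \<open>c\<close> rotates the inner
  product onto the nonnegative real axis, where the real Cauchy-Schwarz inequality applies.\<close>

lemma cmod_cinner_le: "cmod (cinner x y) \<le> norm x * norm (y :: 'a::chilbert_space)"
proof (cases "cinner x y = 0")
  case False
  define c where "c = cnj (sgn (cinner x y))"
  have c: "cmod c = 1"
    using False by (simp add: c_def norm_sgn)
  have "c * cinner x y = of_real (cmod (cinner x y))"
    using False complex_norm_square[of "cinner x y"]
    by (simp add: c_def sgn_eq field_simps power2_eq_square)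
  then have "cmod (cinner x y) = inner x (c *\<^sub>C y)"
    by (metis Re_cinner cinner_scaleC_right Re_complex_of_real)
  also have "\<dots> \<le> norm x * norm (c *\<^sub>C y)"
    by (rule norm_cauchy_schwarz)
  finally show ?thesis
    by (simp add: norm_scaleC c)
qed simp

lemma bounded_linear_cinner_right: "bounded_linear (\<lambda>y. cinner x (y :: 'a::chilbert_space))"
proof (rule bounded_linear_intro)
  fix y z and r :: real
  show "cinner x (y + z) = cinner x y + cinner x z"
    by (rule cinner_add_right)
  show "cinner x (r *\<^sub>R y) = r *\<^sub>R cinner x y"
    by (metis cinner_scaleC_right scaleC_of_real scaleR_conv_of_real)
  show "norm (cinner x y) \<le> norm y * norm x"
    by (metis cmod_cinner_le mult.commute)
qed

text \<open>Polarization recovers the real inner product from the norm, and complex linearity then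
  recovers the imaginary part.\<close>

lemma norm_eq_imp_cinner_eq:
  fixes T :: "'a::chilbert_space \<Rightarrow> 'b::chilbert_space"
  assumes add: "\<And>x y. T (x + y) = T x + T y" and scale: "\<And>c x. T (c *\<^sub>C x) = c *\<^sub>C T x"
    and norm: "\<And>x. norm (T x) = norm x"
  shows "cinner (T x) (T y) = cinner x y"
proof -
  have "inner (T x) (T y) = inner x y" for x y
    using norm[of "x + y"] by (simp add: dot_norm add[symmetric] norm)
  then show ?thesis
    by (simp add: cinner_eq_Complex scale[symmetric])
qed

section \<open>Orthonormal families: Bessel, Riesz-Fischer and Fourier expansion\<close>

definition orthonormal_on :: "'i set \<Rightarrow> ('i \<Rightarrow> 'a::chilbert_space) \<Rightarrow> bool" where
  "orthonormal_on I e \<longleftrightarrow> (\<forall>i\<in>I. \<forall>j\<in>I. cinner (e i) (e j) = (if i = j then 1 else 0))"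

context
  fixes I :: "'i set" and e :: "'i \<Rightarrow> 'a::chilbert_space"
  assumes orthonormal: "orthonormal_on I e"
begin

lemma cinner_orthonormal_sum:
  assumes "finite F" "F \<subseteq> I" "i \<in> I"
  shows "cinner (e i) (\<Sum>j\<in>F. c j *\<^sub>C e j) = (if i \<in> F then c i else 0)"
proof -
  have "cinner (e i) (\<Sum>j\<in>F. c j *\<^sub>C e j) = (\<Sum>j\<in>F. if i = j then c j else 0)"
    unfolding cinner_sum_right cinner_scaleC_right
    by (rule sum.cong) (use assms orthonormal in \<open>auto simp: orthonormal_on_def subset_iff\<close>)
  then show ?thesis
    using assms(1) by simp
qed

lemma norm_orthonormal_sum:
  assumes "finite F" "F \<subseteq> I"
  shows "(norm (\<Sum>j\<in>F. c j *\<^sub>C e j))\<^sup>2 = (\<Sum>j\<in>F. (cmod (c j))\<^sup>2)"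
proof -
  have "complex_of_real ((norm (\<Sum>j\<in>F. c j *\<^sub>C e j))\<^sup>2) = (\<Sum>i\<in>F. cnj (c i) * c i)"
    unfolding cinner_self[symmetric] cinner_sum_left cinner_scaleC_left
    by (rule sum.cong) (use assms cinner_orthonormal_sum[OF assms] in \<open>auto simp: subset_iff\<close>)
  also have "\<dots> = complex_of_real (\<Sum>j\<in>F. (cmod (c j))\<^sup>2)"
    unfolding of_real_sum by (intro sum.cong) (simp_all add: complex_norm_square mult.commute flip: of_real_power)
  finally show ?thesis
    using of_real_eq_iff by blast
qed

text \<open>The inner product of the partial Fourier sum \<open>p\<close> with \<open>h\<close> is
  the squared norm of \<open>p\<close>, so Cauchy-Schwarz bounds \<open>norm p\<close> by
  \<open>norm h\<close>.\<close>

lemma bessel_finite: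
  assumes "finite F" "F \<subseteq> I"
  shows "(\<Sum>i\<in>F. (cmod (cinner (e i) h))\<^sup>2) \<le> (norm h)\<^sup>2"
proof -
  define p where "p = (\<Sum>i\<in>F. cinner (e i) h *\<^sub>C e i)"
  have p: "(norm p)\<^sup>2 = (\<Sum>i\<in>F. (cmod (cinner (e i) h))\<^sup>2)"
    unfolding p_def by (rule norm_orthonormal_sum[OF assms])
  have "cinner p h = (\<Sum>i\<in>F. cnj (cinner (e i) h) * cinner (e i) h)"
    by (simp add: p_def cinner_sum_left cinner_scaleC_left)
  also have "\<dots> = complex_of_real ((norm p)\<^sup>2)"
    unfolding p of_real_sum by (intro sum.cong) (simp_all add: complex_norm_square mult.commute flip: of_real_power)
  finally have "(norm p)\<^sup>2 \<le> norm p * norm h"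
    by (metis Re_cinner Re_complex_of_real norm_cauchy_schwarz)
  then have "norm p \<le> norm h"
    by (cases "norm p = 0") (simp_all add: power2_eq_square)
  then show ?thesis
    using p by (metis norm_ge_zero power_mono)
qed

lemma bessel_summable: "(\<lambda>i. (cmod (cinner (e i) h))\<^sup>2) summable_on I"
  by (rule nonneg_bdd_above_summable_on)
     (auto intro!: bdd_aboveI[of _ "(norm h)\<^sup>2"] bessel_finite)

text \<open>By Pythagoras the distance between partial sums is controlled by the tails of the
  square-summable coefficients, so the net of finite partial sums is Cauchy and completeness
  applies.\<close>

lemma orthonormal_summable:
  assumes "(\<lambda>i. (cmod (c i))\<^sup>2) summable_on I"
  shows "(\<lambda>i. c i *\<^sub>C e i) summable_on I"
proof -
  let ?f = "\<lambda>i. c i *\<^sub>C e i"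
  obtain s where s: "(sum (\<lambda>i. (cmod (c i))\<^sup>2) \<longlongrightarrow> s) (finite_subsets_at_top I)"
    using assms by (auto simp: summable_on_def has_sum_def)
  have "\<exists>P. eventually P (finite_subsets_at_top I) \<and>
      (\<forall>F F'. P F \<and> P F' \<longrightarrow> dist (sum ?f F) (sum ?f F') < \<epsilon>)" if "\<epsilon> > 0" for \<epsilon>
  proof -
    \<comment> \<open>Two numbers within \<open>\<delta>\<close> of \<open>s\<close> differ by less
      than \<open>2 * \<delta> = (\<epsilon> / 2)\<^sup>2\<close>, so the partial sum over
      \<open>G\<close> is within \<open>\<epsilon> / 2\<close> of that over every larger finite
      set.\<close>
    define \<delta> where "\<delta> = \<epsilon>\<^sup>2 / 8"
    have "\<delta> > 0"
      using that by (simp add: \<delta>_def)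
    then have "eventually (\<lambda>F. dist (\<Sum>i\<in>F. (cmod (c i))\<^sup>2) s < \<delta>) (finite_subsets_at_top I)"
      using s tendstoD by blast
    then obtain G where G: "finite G" "G \<subseteq> I"
      and near: "\<And>F. finite F \<Longrightarrow> G \<subseteq> F \<Longrightarrow> F \<subseteq> I \<Longrightarrow> dist (\<Sum>i\<in>F. (cmod (c i))\<^sup>2) s < \<delta>"
      unfolding eventually_finite_subsets_at_top by metis
    have step: "dist (sum ?f F) (sum ?f G) < \<epsilon> / 2" if F: "finite F" "G \<subseteq> F" "F \<subseteq> I" for F
    proof -
      have "(dist (sum ?f F) (sum ?f G))\<^sup>2 = (norm (sum ?f (F - G)))\<^sup>2"
        using F G by (simp add: dist_norm sum_diff)
      also have "\<dots> = (\<Sum>i\<in>F - G. (cmod (c i))\<^sup>2)"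
        using F by (intro norm_orthonormal_sum) auto
      also have "\<dots> = (\<Sum>i\<in>F. (cmod (c i))\<^sup>2) - (\<Sum>i\<in>G. (cmod (c i))\<^sup>2)"
        using F by (simp add: sum_diff)
      also have "\<dots> < 2 * \<delta>"
        using near[OF F] near[of G] G by (auto simp: dist_real_def abs_if split: if_splits)
      also have "\<dots> = (\<epsilon> / 2)\<^sup>2"
        by (simp add: \<delta>_def power2_eq_square)
      finally show ?thesis
        by (rule power2_less_imp_less) (use \<open>\<epsilon> > 0\<close> in simp)
    qed
    show ?thesis
    proof (intro exI[of _ "\<lambda>F. finite F \<and> G \<subseteq> F \<and> F \<subseteq> I"] conjI allI impI)
      show "eventually (\<lambda>F. finite F \<and> G \<subseteq> F \<and> F \<subseteq> I) (finite_subsets_at_top I)"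
        using G by (auto simp: eventually_finite_subsets_at_top)
      fix F F'
      assume "(finite F \<and> G \<subseteq> F \<and> F \<subseteq> I) \<and> finite F' \<and> G \<subseteq> F' \<and> F' \<subseteq> I"
      then show "dist (sum ?f F) (sum ?f F') < \<epsilon>"
        using step[of F] step[of F'] dist_triangle2[of "sum ?f F" "sum ?f F'" "sum ?f G"]
        by linarith
    qed
  qed
  then have "cauchy_filter (filtermap (sum ?f) (finite_subsets_at_top I))"
    by (simp add: cauchy_filter_metric_filtermap)
  then have "convergent_filter (filtermap (sum ?f) (finite_subsets_at_top I))"
    by (rule cauchy_filter_convergent)
  then show ?thesis
    unfolding convergent_filter_iff summable_on_def has_sum_def filterlim_def by blast
qed

lemma cinner_orthonormal_infsum:
  assumes "(\<lambda>i. (cmod (c i))\<^sup>2) summable_on I" and i: "i \<in> I"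
  shows "cinner (e i) (\<Sum>\<^sub>\<infinity>j\<in>I. c j *\<^sub>C e j) = c i"
proof -
  have "((\<lambda>j. cinner (e i) (c j *\<^sub>C e j)) has_sum cinner (e i) (\<Sum>\<^sub>\<infinity>j\<in>I. c j *\<^sub>C e j)) I"
    by (intro has_sum_bounded_linear[OF bounded_linear_cinner_right] has_sum_infsum
        orthonormal_summable assms)
  moreover have "((\<lambda>j. cinner (e i) (c j *\<^sub>C e j)) has_sum c i) I"
  proof (rule has_sum_cong_neutral[where S = "{i}" and f = "\<lambda>_. c i", THEN iffD1])
    show "((\<lambda>_. c i) has_sum c i) {i}"
      using has_sum_finite[of "{i}" "\<lambda>_. c i"] by simp
  qed (use i orthonormal in \<open>auto simp: orthonormal_on_def cinner_scaleC_right\<close>)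
  ultimately show ?thesis
    by (rule has_sum_unique)
qed

text \<open>The difference of \<open>h\<close> and its Fourier sum lies in \<open>M\<close> and is
  orthogonal to every \<open>e i\<close>, hence vanishes by totality.\<close>

lemma orthonormal_expansion:
  assumes M: "closed_csubspace M" and e: "\<And>i. i \<in> I \<Longrightarrow> e i \<in> M"
    and total: "\<And>x. x \<in> M \<Longrightarrow> (\<And>i. i \<in> I \<Longrightarrow> cinner (e i) x = 0) \<Longrightarrow> x = 0"
    and mem: "(\<Sum>\<^sub>\<infinity>i\<in>I. cinner (e i) h *\<^sub>C e i) \<in> M" and h: "h \<in> M"
  shows "(\<Sum>\<^sub>\<infinity>i\<in>I. cinner (e i) h *\<^sub>C e i) = h"
proof -
  let ?p = "\<Sum>\<^sub>\<infinity>i\<in>I. cinner (e i) h *\<^sub>C e i"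
  have "h + (- 1) *\<^sub>C ?p \<in> M"
    using M mem h unfolding closed_csubspace_def by blast
  then have "h - ?p \<in> M"
    by (simp add: scaleC_minus_one)
  moreover have "cinner (e i) (h - ?p) = 0" if "i \<in> I" for i
    using cinner_orthonormal_infsum[OF bessel_summable that] by (simp add: cinner_diff_right)
  ultimately show ?thesis
    using total by fastforce
qed

end

section \<open>Closed complex subspaces and maximal orthonormal sets\<close>

lemma closed_csubspaceD:
  assumes "closed_csubspace M"
  shows "closed M" "0 \<in> M" "x \<in> M \<Longrightarrow> y \<in> M \<Longrightarrow> x + y \<in> M" "x \<in> M \<Longrightarrow> c *\<^sub>C x \<in> M"
    "x \<in> M \<Longrightarrow> - x \<in> M" "x \<in> M \<Longrightarrow> y \<in> M \<Longrightarrow> x - y \<in> M"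
proof -
  show "closed M" "0 \<in> M" and add: "\<And>x y. x \<in> M \<Longrightarrow> y \<in> M \<Longrightarrow> x + y \<in> M"
    and scale: "\<And>c x. x \<in> M \<Longrightarrow> c *\<^sub>C x \<in> M"
    using assms unfolding closed_csubspace_def by blast+
  show minus: "- x \<in> M" if "x \<in> M" for x
    using scale[OF that, of "- 1"] by (simp add: scaleC_minus_one)
  show "x - y \<in> M" if "x \<in> M" "y \<in> M" for x y
    using add[OF that(1) minus[OF that(2)]] by simp
qed

lemma closed_csubspace_sum:
  assumes "closed_csubspace M" "\<And>i. i \<in> F \<Longrightarrow> f i \<in> M"
  shows "(\<Sum>i\<in>F. f i) \<in> M"
  using assms(2)
  by (induction F rule: infinite_finite_induct) (auto intro: closed_csubspaceD[OF assms(1)])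

text \<open>Limits of finite sums stay in a closed subspace; for a family that is not summable the
  value is the default 0, which lies in \<open>M\<close> as well.\<close>

lemma closed_csubspace_infsum:
  assumes M: "closed_csubspace M" and f: "\<And>i. i \<in> I \<Longrightarrow> f i \<in> M"
  shows "(\<Sum>\<^sub>\<infinity>i\<in>I. f i) \<in> M"
proof (cases "f summable_on I")
  case True
  have "\<forall>\<^sub>F F in finite_subsets_at_top I. sum f F \<in> M"
    by (rule eventually_finite_subsets_at_top_weakI) (use M f in \<open>auto intro: closed_csubspace_sum\<close>)
  with closed_csubspaceD(1)[OF M] True show ?thesis
    by (intro Lim_in_closed_set[of M _ "finite_subsets_at_top I"])
       (auto simp: has_sum_def dest: has_sum_infsum)
qed (use closed_csubspaceD[OF M] in \<open>simp add: infsum_not_exists\<close>)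

text \<open>Zorn's lemma. Closure of \<open>E\<close> under scalars allows a nonzero vector of
  \<open>E\<close> orthogonal to \<open>J\<close> to be normalized inside \<open>E\<close> and added
  to \<open>J\<close>.\<close>

lemma exists_maximal_orthonormal:
  fixes E :: "'a::chilbert_space set"
  assumes scale: "\<And>c x. x \<in> E \<Longrightarrow> c *\<^sub>C x \<in> E"
  obtains J where "J \<subseteq> E" "orthonormal_on J (\<lambda>x. x)"
    "\<And>x. x \<in> E \<Longrightarrow> (\<And>j. j \<in> J \<Longrightarrow> cinner j x = 0) \<Longrightarrow> x = 0"
proof -
  let ?\<A> = "{J. J \<subseteq> E \<and> orthonormal_on J (\<lambda>x. x)}"
  have "\<exists>J\<in>?\<A>. \<forall>X\<in>?\<A>. J \<subseteq> X \<longrightarrow> X = J"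
  proof (rule Zorn_Lemma, rule ballI)
    fix C assume "C \<in> chains ?\<A>"
    then have C: "C \<subseteq> ?\<A>" and chain: "\<And>X Y. X \<in> C \<Longrightarrow> Y \<in> C \<Longrightarrow> X \<subseteq> Y \<or> Y \<subseteq> X"
      by (auto simp: chains_def chain_subset_def)
    have "cinner x y = (if x = y then 1 else 0)" if xy: "x \<in> \<Union>C" "y \<in> \<Union>C" for x y
    proof -
      obtain X where "X \<in> C" "x \<in> X" "y \<in> X"
        using xy chain by blast
      then show ?thesis
        using C by (auto simp: orthonormal_on_def)
    qed
    then show "\<Union>C \<in> ?\<A>"
      using C by (auto simp: orthonormal_on_def)
  qed
  then obtain J where "J \<in> ?\<A>" and J_max: "\<forall>X\<in>?\<A>. J \<subseteq> X \<longrightarrow> X = J"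
    by (rule bexE)
  then have J: "J \<subseteq> E" "orthonormal_on J (\<lambda>x. x)"
    and max: "\<And>X. X \<subseteq> E \<Longrightarrow> orthonormal_on X (\<lambda>x. x) \<Longrightarrow> J \<subseteq> X \<Longrightarrow> X = J"
    by simp_all
  have "x = 0" if x: "x \<in> E" "\<And>j. j \<in> J \<Longrightarrow> cinner j x = 0" for x
  proof (rule ccontr)
    assume "x \<noteq> 0"
    define u where "u = complex_of_real (1 / norm x) *\<^sub>C x"
    have "norm u = 1"
      using \<open>x \<noteq> 0\<close> by (simp add: u_def norm_scaleC norm_divide)
    then have u: "cinner u u = 1"
      by (simp add: cinner_self)
    have ortho: "cinner j u = 0" "cinner u j = 0" if "j \<in> J" for j
      using x(2)[OF that] x(2)[OF that, unfolded cinner_eq_0_commute[of j]]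
      by (simp_all add: u_def cinner_scaleC_right cinner_scaleC_left)
    have "u \<in> E"
      using x(1) by (simp add: u_def scale)
    moreover have "u \<notin> J"
      using ortho(1)[of u] u by auto
    ultimately have "insert u J = J"
      using J u ortho by (intro max) (auto simp: orthonormal_on_def)
    with \<open>u \<notin> J\<close> show False
      by blast
  qed
  with J show ?thesis
    by (intro that[of J]) blast+
qed

section \<open>Orthogonal complements and projections\<close>

definition orthocomp :: "'a::chilbert_space set \<Rightarrow> 'a set" where
  "orthocomp M = {x. \<forall>m\<in>M. cinner m x = 0}"

lemma orthocomp_cinner: "x \<in> orthocomp M \<Longrightarrow> m \<in> M \<Longrightarrow> cinner m x = 0"
  and orthocomp_cinner': "x \<in> orthocomp M \<Longrightarrow> m \<in> M \<Longrightarrow> cinner x m = 0"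
  by (auto simp: orthocomp_def cinner_eq_0_commute[of x])

lemma orthocomp_Int_eq_0: "x \<in> M \<Longrightarrow> x \<in> orthocomp M \<Longrightarrow> x = 0"
  by (metis cinner_self_eq_0_iff orthocomp_cinner)

lemma closed_csubspace_orthocomp: "closed_csubspace (orthocomp M)"
proof -
  have "closed (\<Inter>m\<in>M. {x. cinner m x = 0})"
    by (intro closed_INT ballI closed_Collect_eq linear_continuous_on bounded_linear_cinner_right
        continuous_on_const)
  also have "(\<Inter>m\<in>M. {x. cinner m x = 0}) = orthocomp M"
    by (auto simp: orthocomp_def)
  finally show ?thesis
    by (simp add: closed_csubspace_def orthocomp_def cinner_add_right cinner_scaleC_right)
qed

lemma closed_csubspace_Int:
  "closed_csubspace M \<Longrightarrow> closed_csubspace N \<Longrightarrow> closed_csubspace (M \<inter> N)"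
  by (simp add: closed_csubspace_def closed_Int)

lemma closed_csubspace_Inter:
  "(\<And>i. i \<in> I \<Longrightarrow> closed_csubspace (M i)) \<Longrightarrow> closed_csubspace (\<Inter>i\<in>I. M i)"
  by (simp add: closed_csubspace_def closed_INT)

lemma closed_csubspace_UNIV: "closed_csubspace UNIV"
  by (simp add: closed_csubspace_def)

text \<open>The component \<open>p\<close> is the Fourier sum of \<open>h\<close> over a maximal
  orthonormal subset of \<open>M\<close>. Each element of \<open>M\<close> equals its own Fourier
  sum, so orthogonality of \<open>h - p\<close> to that subset extends to all of
  \<open>M\<close>.\<close>

lemma orthogonal_projection:
  assumes M: "closed_csubspace (M :: 'a::chilbert_space set)"
  obtains p q where "p \<in> M" "q \<in> orthocomp M" "h = p + q"
proof -
  obtain J where J: "J \<subseteq> M" and on: "orthonormal_on J (\<lambda>x. x)"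
    and total: "\<And>x. x \<in> M \<Longrightarrow> (\<And>j. j \<in> J \<Longrightarrow> cinner j x = 0) \<Longrightarrow> x = 0"
    using exists_maximal_orthonormal[of M] closed_csubspaceD(4)[OF M] by metis
  have mem: "(\<Sum>\<^sub>\<infinity>j\<in>J. cinner j x *\<^sub>C j) \<in> M" for x
    using J by (intro closed_csubspace_infsum M closed_csubspaceD(4)[OF M]) auto
  define p where "p = (\<Sum>\<^sub>\<infinity>j\<in>J. cinner j h *\<^sub>C j)"
  have ortho: "cinner (h - p) j = 0" if "j \<in> J" for j
    using cinner_orthonormal_infsum[OF on bessel_summable[OF on] that]
    by (subst cinner_eq_0_commute) (simp add: p_def cinner_diff_right)
  have "cinner (h - p) m = 0" if m: "m \<in> M" for m
  proof -
    have "cinner (h - p) (\<Sum>\<^sub>\<infinity>j\<in>J. cinner j m *\<^sub>C j) = (\<Sum>\<^sub>\<infinity>j\<in>J. cinner (h - p) (cinner j m *\<^sub>C j))"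
      using orthonormal_summable[OF on bessel_summable[OF on]]
      by (intro infsumI[symmetric] has_sum_bounded_linear[OF bounded_linear_cinner_right]
          has_sum_infsum)
    then have "cinner (h - p) (\<Sum>\<^sub>\<infinity>j\<in>J. cinner j m *\<^sub>C j) = 0"
      by (simp add: cinner_scaleC_right ortho infsum_0)
    moreover have "(\<Sum>\<^sub>\<infinity>j\<in>J. cinner j m *\<^sub>C j) = m"
      by (rule orthonormal_expansion[OF on M _ total mem m]) (use J in auto)
    ultimately show ?thesis
      by simp
  qed
  then have "h - p \<in> orthocomp M"
    by (simp add: orthocomp_def cinner_eq_0_commute[of _ "h - p"])
  with mem[of h] show ?thesis
    by (intro that[of p "h - p"]) (simp_all add: p_def)
qed

declare One_nat_def [simp del]

section \<open>Isometries and reducing subspaces\<close>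

abbreviation adj :: "('a::chilbert_space \<Rightarrow> 'a) \<Rightarrow> 'a \<Rightarrow> 'a" where
  "adj T \<equiv> adjoint_on UNIV T"

lemma bounded_linear_ccontraction:
  fixes f :: "'a::chilbert_space \<Rightarrow> 'b::chilbert_space"
  assumes "\<And>x y. f (x + y) = f x + f y" "\<And>c x. f (c *\<^sub>C x) = c *\<^sub>C f x"
    and "\<And>x. norm (f x) \<le> norm x"
  shows "bounded_linear f"
proof (rule bounded_linear_intro)
  show "f (r *\<^sub>R x) = r *\<^sub>R f x" for r x
    by (metis assms(2) scaleC_of_real)
  show "norm (f x) \<le> norm x * 1" for x
    using assms(3) by simp
qed (rule assms(1))

section \<open>The adjoint of an isometry\<close>

context
  fixes T :: "'a::chilbert_space \<Rightarrow> 'a"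
  assumes iso: "isometry_on UNIV T"
begin

lemma iso_add: "T (x + y) = T x + T y"
  and iso_scaleC: "T (c *\<^sub>C x) = c *\<^sub>C T x"
  and iso_norm: "norm (T x) = norm x"
  using iso by (simp_all add: isometry_on_def clinear_on_def)

lemma iso_zero: "T 0 = 0"
  using iso_norm[of 0] by simp

lemma iso_sum: "T (\<Sum>i\<in>F. f i) = (\<Sum>i\<in>F. T (f i))"
  by (induction F rule: infinite_finite_induct) (simp_all add: iso_add iso_zero)

lemma iso_cinner: "cinner (T x) (T y) = cinner x y"
  by (rule norm_eq_imp_cinner_eq) (simp_all add: iso_add iso_scaleC iso_norm)

lemma bounded_linear_iso: "bounded_linear T"
  by (rule bounded_linear_ccontraction) (simp_all add: iso_add iso_scaleC iso_norm)

text \<open>Closedness comes from completeness: an isometric image of a complete space is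
  complete.\<close>

lemma closed_csubspace_range: "closed_csubspace (range T)"
proof -
  have "complete (range T)"
    by (rule complete_isometric_image[of 1])
      (auto simp: iso_norm bounded_linear_iso complete_UNIV)
  moreover have "c *\<^sub>C T x \<in> range T" "T x + T y \<in> range T" "0 \<in> range T" for c x y
    by (metis iso_scaleC iso_add iso_zero rangeI)+
  ultimately show ?thesis
    by (auto simp: closed_csubspace_def complete_imp_closed)
qed

text \<open>Write \<open>y = T z + q\<close> with \<open>q\<close> orthogonal to the range of
  \<open>T\<close>; the isometry property gives \<open>cinner (T x) y = cinner x z\<close>. So the
  definite description in \<open>adjoint_on\<close> denotes.\<close>

lemma cinner_adj: "cinner (T x) y = cinner x (adj T y)"
proof -
  obtain p q where "p \<in> range T" and q: "q \<in> orthocomp (range T)" and y: "y = p + q"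
    using orthogonal_projection[OF closed_csubspace_range] .
  then obtain z where z: "p = T z"
    by blast
  have "cinner (T x) y = cinner x z" for x
    using q by (simp add: y z cinner_add_right iso_cinner orthocomp_cinner)
  then have "\<exists>!z. z \<in> UNIV \<and> (\<forall>x\<in>UNIV. cinner (T x) y = cinner x z)"
    using cinner_ext by (metis UNIV_I)
  from theI'[OF this] show ?thesis
    unfolding adjoint_on_def by blast
qed

lemma cinner_adj': "cinner x (T y) = cinner (adj T x) y"
  by (metis cinner_adj cinner_commute)

lemma adj_iso: "adj T (T x) = x"
  by (rule cinner_ext) (simp add: cinner_adj[symmetric] iso_cinner)

lemma adj_add: "adj T (x + y) = adj T x + adj T y"
  by (rule cinner_ext) (simp add: cinner_adj[symmetric] cinner_add_right)

lemma adj_scaleC: "adj T (c *\<^sub>C x) = c *\<^sub>C adj T x"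
  by (rule cinner_ext) (simp add: cinner_adj[symmetric] cinner_scaleC_right)

lemma adj_zero: "adj T 0 = 0"
  using adj_scaleC[of 0 0] by simp

lemma adj_diff: "adj T (x - y) = adj T x - adj T y"
  by (rule cinner_ext) (simp add: cinner_adj[symmetric] cinner_diff_right)

lemma adj_sum: "adj T (\<Sum>i\<in>F. f i) = (\<Sum>i\<in>F. adj T (f i))"
  by (induction F rule: infinite_finite_induct) (simp_all add: adj_add adj_zero)

text \<open>The squared norm of \<open>adj T x\<close> is the inner product of
  \<open>T (adj T x)\<close> and \<open>x\<close>, at most \<open>norm (adj T x) * norm x\<close> by
  Cauchy-Schwarz; so the adjoint is a contraction.\<close>

lemma bounded_linear_adj: "bounded_linear (adj T)"
proof (rule bounded_linear_ccontraction)
  fix x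
  have "complex_of_real ((norm (adj T x))\<^sup>2) = cinner (T (adj T x)) x"
    by (simp only: cinner_self[symmetric] cinner_adj)
  then have "(norm (adj T x))\<^sup>2 = cmod (cinner (T (adj T x)) x)"
    by (metis norm_of_real abs_power2)
  also have "\<dots> \<le> norm (adj T x) * norm x"
    using cmod_cinner_le[of "T (adj T x)" x] by (simp add: iso_norm)
  finally show "norm (adj T x) \<le> norm x"
    by (cases "norm (adj T x) = 0") (simp_all add: power2_eq_square)
qed (simp_all add: adj_add adj_scaleC)

lemma reduces_orthocomp:
  assumes "reduces M T"
  shows "reduces (orthocomp M) T"
  using assms closed_csubspace_orthocomp[of M]
  by (auto simp: reduces_def orthocomp_def cinner_adj[symmetric] cinner_adj')

text \<open>Reduction keeps \<open>adj T y\<close> in \<open>M\<close>; any other representing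
  vector in \<open>M\<close> would differ from it by a vector of \<open>M\<close> orthogonal to
  itself.\<close>

lemma adjoint_on_reducing:
  assumes M: "reduces M T" and y: "y \<in> M"
  shows "adjoint_on M T y = adj T y"
proof (subst adjoint_on_def, rule the_equality)
  show "adj T y \<in> M \<and> (\<forall>x\<in>M. cinner (T x) y = cinner x (adj T y))"
    using M y by (simp add: reduces_def cinner_adj)
  fix z assume z: "z \<in> M \<and> (\<forall>x\<in>M. cinner (T x) y = cinner x z)"
  then have "z - adj T y \<in> M"
    using M y by (auto simp: reduces_def intro: closed_csubspaceD)
  then have "cinner (z - adj T y) (z - adj T y) = 0"
    using z by (simp add: cinner_diff_right cinner_adj)
  then show "z = adj T y"
    by simp
qed

end

lemma reduces_Int: "reduces M T \<Longrightarrow> reduces N T \<Longrightarrow> reduces (M \<inter> N) T"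
  by (simp add: reduces_def closed_csubspace_Int)

lemma isometry_on_subset:
  assumes "isometry_on UNIV T" "\<And>x. x \<in> M \<Longrightarrow> T x \<in> M"
  shows "isometry_on M T"
  using assms by (simp add: isometry_on_def clinear_on_def)

lemma closed_csubspace_vimage:
  assumes "bounded_linear f" "\<And>c x. f (c *\<^sub>C x) = c *\<^sub>C f x" "closed_csubspace M"
  shows "closed_csubspace (f -` M)"
  using assms closed_csubspaceD[OF assms(3)]
  by (simp add: closed_csubspace_def closed_vimage linear_continuous_on bounded_linear.linear
      linear_add linear_0)

lemma orthogonal_sum_unique:
  assumes M: "closed_csubspace M" and "p \<in> M" "p' \<in> M" "q \<in> orthocomp M" "q' \<in> orthocomp M"
    and eq: "p + q = p' + q'"
  shows "p = p'"
proof -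
  have "p - p' \<in> M" "q' - q \<in> orthocomp M"
    using assms closed_csubspaceD[OF closed_csubspace_orthocomp] by (auto intro: closed_csubspaceD)
  moreover have "p - p' = q' - q"
    using eq by (simp add: algebra_simps)
  ultimately show ?thesis
    using orthocomp_Int_eq_0 by fastforce
qed

section \<open>The Wold decomposition of a row isometry\<close>

lemma free_words_0: "free_words n 0 = {[]}"
  by (auto simp: free_words_def)

lemma free_words_Suc: "free_words n (Suc m) = (\<lambda>(k, \<mu>). k # \<mu>) ` ({1..n} \<times> free_words n m)"
proof (rule Set.set_eqI)
  fix \<mu> :: "nat list"
  show "\<mu> \<in> free_words n (Suc m) \<longleftrightarrow> \<mu> \<in> (\<lambda>(k, \<mu>). k # \<mu>) ` ({1..n} \<times> free_words n m)"
    by (cases \<mu>) (auto simp: free_words_def image_iff)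
qed

lemma sum_free_words_Suc:
  "(\<Sum>\<mu>\<in>free_words n (Suc m). f \<mu>) = (\<Sum>k=1..n. \<Sum>\<mu>\<in>free_words n m. f (k # \<mu>))"
  unfolding free_words_Suc sum.cartesian_product
  by (subst sum.reindex) (auto simp: inj_on_def intro!: sum.cong)

lemma row_range_0: "row_range M n V 0 = M"
  by (auto simp: row_range_def free_words_0 intro: exI[of _ "\<lambda>_. x" for x])

locale row_isometry =
  fixes n :: nat and V :: "nat \<Rightarrow> 'a::chilbert_space \<Rightarrow> 'a"
  assumes row: "row_isometry_on UNIV n V"
begin

lemma isom: "k \<in> {1..n} \<Longrightarrow> isometry_on UNIV (V k)"
  using row by (simp add: row_isometry_on_def)

lemma adj_row:
  assumes "j \<in> {1..n}" "k \<in> {1..n}"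
  shows "adj (V j) (V k x) = (if j = k then x else 0)"
proof (cases "j = k")
  case False
  have "adj (V j) (V k x) = 0"
    by (rule cinner_ext) (use False row assms in \<open>simp add: cinner_adj[OF isom, symmetric] row_isometry_on_def\<close>)
  with False show ?thesis
    by simp
qed (use assms in \<open>simp add: adj_iso isom\<close>)

text \<open>The orthogonal projection onto the direct sum of the ranges of the
  \<open>V k\<close>.\<close>

definition row_proj :: "'a \<Rightarrow> 'a" where
  "row_proj x = (\<Sum>k=1..n. V k (adj (V k) x))"

lemma adj_row_sum:
  assumes "j \<in> {1..n}"
  shows "adj (V j) (\<Sum>k=1..n. V k (y k)) = y j"
  using assms by (simp add: adj_sum isom adj_row sum.delta if_distrib cong: if_cong)

lemma row_proj_sum: "row_proj (\<Sum>k=1..n. V k (y k)) = (\<Sum>k=1..n. V k (y k))"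
  unfolding row_proj_def by (intro sum.cong HOL.refl) (simp add: adj_row_sum)

text \<open>Words of length \<open>Suc m\<close> are split at the first letter, and
  \<open>V k\<close> is pulled out of the sum by linearity.\<close>

lemma row_range_Suc:
  "row_range M n V (Suc m) = {\<Sum>k=1..n. V k (y k) | y. \<forall>k\<in>{1..n}. y k \<in> row_range M n V m}"
proof (intro equalityI subsetI)
  fix z assume "z \<in> row_range M n V (Suc m)"
  then obtain x where x: "\<forall>\<mu>\<in>free_words n (Suc m). x \<mu> \<in> M"
    and z: "z = (\<Sum>\<mu>\<in>free_words n (Suc m). foldr V \<mu> (x \<mu>))"
    unfolding row_range_def by blast
  define y where "y = (\<lambda>k. \<Sum>\<mu>\<in>free_words n m. foldr V \<mu> (x (k # \<mu>)))"
  have "y k \<in> row_range M n V m" if "k \<in> {1..n}" for k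
    unfolding row_range_def y_def mem_Collect_eq
    using that x by (intro exI[of _ "\<lambda>\<mu>. x (k # \<mu>)"]) (auto simp: free_words_Suc)
  moreover have "z = (\<Sum>k=1..n. V k (y k))"
    unfolding z sum_free_words_Suc by (intro sum.cong HOL.refl) (simp add: y_def iso_sum isom)
  ultimately show "z \<in> {\<Sum>k=1..n. V k (y k) | y. \<forall>k\<in>{1..n}. y k \<in> row_range M n V m}"
    by blast
next
  fix z assume "z \<in> {\<Sum>k=1..n. V k (y k) | y. \<forall>k\<in>{1..n}. y k \<in> row_range M n V m}"
  then obtain y where y: "\<forall>k\<in>{1..n}. y k \<in> row_range M n V m" and z: "z = (\<Sum>k=1..n. V k (y k))"
    by blast
  from y have "\<forall>k\<in>{1..n}. \<exists>x. (\<forall>\<mu>\<in>free_words n m. x \<mu> \<in> M) \<and>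
      y k = (\<Sum>\<mu>\<in>free_words n m. foldr V \<mu> (x \<mu>))"
    unfolding row_range_def by blast
  then obtain x where x: "\<And>k. k \<in> {1..n} \<Longrightarrow> \<forall>\<mu>\<in>free_words n m. x k \<mu> \<in> M"
    and y_eq: "\<And>k. k \<in> {1..n} \<Longrightarrow> y k = (\<Sum>\<mu>\<in>free_words n m. foldr V \<mu> (x k \<mu>))"
    by metis
  \<comment> \<open>The families \<open>x k\<close>, one for each first letter, are glued to a
    single family on words through head and tail.\<close>
  have "z = (\<Sum>\<mu>\<in>free_words n (Suc m). foldr V \<mu> (x (hd \<mu>) (tl \<mu>)))"
    unfolding z sum_free_words_Suc by (intro sum.cong HOL.refl) (simp add: y_eq iso_sum isom)
  moreover have "\<forall>\<mu>\<in>free_words n (Suc m). x (hd \<mu>) (tl \<mu>) \<in> M"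
    using x by (auto simp: free_words_Suc)
  ultimately show "z \<in> row_range M n V (Suc m)"
    unfolding row_range_def by (intro CollectI exI[of _ "\<lambda>\<mu>. x (hd \<mu>) (tl \<mu>)"] conjI)
qed

text \<open>Because the ranges are orthogonal, the coefficients in \<open>row_range_Suc\<close> can
  only be \<open>adj (V k) x\<close>. This recursion through adjoints underlies the closedness of
  the ranges and the description of \<open>core\<close>.\<close>

lemma mem_row_range_Suc_iff:
  "x \<in> row_range UNIV n V (Suc m) \<longleftrightarrow>
    row_proj x = x \<and> (\<forall>k\<in>{1..n}. adj (V k) x \<in> row_range UNIV n V m)"
proof
  assume "x \<in> row_range UNIV n V (Suc m)"
  then show "row_proj x = x \<and> (\<forall>k\<in>{1..n}. adj (V k) x \<in> row_range UNIV n V m)"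
    unfolding row_range_Suc by (auto simp: row_proj_sum adj_row_sum)
next
  assume "row_proj x = x \<and> (\<forall>k\<in>{1..n}. adj (V k) x \<in> row_range UNIV n V m)"
  then show "x \<in> row_range UNIV n V (Suc m)"
    unfolding row_range_Suc row_proj_def by (auto intro!: exI[of _ "\<lambda>k. adj (V k) x"])
qed

text \<open>By \<open>mem_row_range_Suc_iff\<close> each range is the kernel of
  \<open>row_proj x - x\<close> cut with preimages of the previous range under the bounded maps
  \<open>adj (V k)\<close>.\<close>

lemma closed_csubspace_row_range: "closed_csubspace (row_range UNIV n V m)"
proof (induction m)
  case 0
  show ?case
    by (simp add: row_range_0 closed_csubspace_UNIV)
next
  case (Suc m)
  have "closed_csubspace ((\<lambda>x. row_proj x - x) -` {0})"
  proof (rule closed_csubspace_vimage)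
    show "bounded_linear (\<lambda>x. row_proj x - x)"
      unfolding row_proj_def
      by (intro bounded_linear_sub bounded_linear_sum bounded_linear_ident
          bounded_linear_compose[OF bounded_linear_iso bounded_linear_adj] isom)
    show "row_proj (c *\<^sub>C x) - c *\<^sub>C x = c *\<^sub>C (row_proj x - x)" for c x
    proof -
      have "c *\<^sub>C (\<Sum>k=1..n. f k) = (\<Sum>k=1..n. c *\<^sub>C f k)" for f :: "nat \<Rightarrow> 'a"
        by (induction n) (simp_all add: scaleC_add_right)
      then show ?thesis
        using scaleC_add_right[of c "row_proj x" "- x"]
        by (simp add: row_proj_def iso_scaleC adj_scaleC isom scaleC_minus_right)
    qed
  qed (simp add: closed_csubspace_def)
  moreover have "closed_csubspace (\<Inter>k\<in>{1..n}. adj (V k) -` row_range UNIV n V m)"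
    by (intro closed_csubspace_Inter closed_csubspace_vimage bounded_linear_adj adj_scaleC isom Suc.IH)
  moreover have "row_range UNIV n V (Suc m) =
      ((\<lambda>x. row_proj x - x) -` {0}) \<inter> (\<Inter>k\<in>{1..n}. adj (V k) -` row_range UNIV n V m)"
    by (auto simp: mem_row_range_Suc_iff)
  ultimately show ?case
    by (simp add: closed_csubspace_Int)
qed

text \<open>The row unitary part in the Wold decomposition; for the one-element row \<open>W\<close>
  it becomes the unitary part of \<open>W\<close>.\<close>

definition core :: "'a set" where
  "core = (\<Inter>m. row_range UNIV n V m)"

lemma closed_csubspace_core: "closed_csubspace core"
  unfolding core_def by (intro closed_csubspace_Inter closed_csubspace_row_range)

lemma core_iff:
  "x \<in> core \<longleftrightarrow> row_proj x = x \<and> (\<forall>k\<in>{1..n}. adj (V k) x \<in> core)"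
proof -
  have "x \<in> core \<longleftrightarrow> (\<forall>m. x \<in> row_range UNIV n V (Suc m))"
    unfolding core_def by (metis INT_iff UNIV_I not0_implies_Suc row_range_0)
  then show ?thesis
    by (auto simp: mem_row_range_Suc_iff core_def)
qed

lemma row_proj_core: "x \<in> core \<Longrightarrow> row_proj x = x"
  and adj_core: "x \<in> core \<Longrightarrow> k \<in> {1..n} \<Longrightarrow> adj (V k) x \<in> core"
  using core_iff[of x] by blast+

text \<open>By induction on \<open>m\<close>, such an \<open>M\<close> lies in every range; with
  \<open>core_iff\<close>, \<open>core\<close> is the largest set with these two properties. Since
  \<open>M\<close> is an arbitrary set, images and unions can be tested directly.\<close>

lemma subset_coreI:
  assumes "\<And>x. x \<in> M \<Longrightarrow> row_proj x = x" "\<And>k x. k \<in> {1..n} \<Longrightarrow> x \<in> M \<Longrightarrow> adj (V k) x \<in> M"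
  shows "M \<subseteq> core"
proof -
  have "M \<subseteq> row_range UNIV n V m" for m
  proof (induction m)
    case (Suc m)
    then show ?case
      using assms by (simp add: mem_row_range_Suc_iff subset_iff)
  qed (simp add: row_range_0)
  then show ?thesis
    by (auto simp: core_def)
qed

text \<open>For \<open>x\<close> in \<open>core\<close>, \<open>adj (V j)\<close> sends
  \<open>V k x\<close> to \<open>x\<close> or to 0, both in \<open>core\<close>.\<close>

lemma reduces_core:
  assumes k: "k \<in> {1..n}"
  shows "reduces core (V k)"
proof -
  have "V k x \<in> core" if "x \<in> core" for x
  proof (subst core_iff, intro conjI ballI)
    have "(\<Sum>j=1..n. V j (if j = k then x else 0)) = (\<Sum>j=1..n. if j = k then V k x else 0)"
      by (intro sum.cong HOL.refl) (simp add: iso_zero isom)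
    also have "\<dots> = V k x"
      using k by simp
    finally show "row_proj (V k x) = V k x"
      using k by (simp add: row_proj_def adj_row)
    show "adj (V j) (V k x) \<in> core" if "j \<in> {1..n}" for j
      using \<open>x \<in> core\<close> k that closed_csubspaceD(2)[OF closed_csubspace_core] by (simp add: adj_row)
  qed
  then show ?thesis
    using k by (simp add: reduces_def closed_csubspace_core adj_core)
qed

end

section \<open>Restriction of a row isometry to a reducing subspace\<close>

locale reducing_subspace = row_isometry +
  fixes M
  assumes subspace: "closed_csubspace M" and red: "\<And>k. k \<in> {1..n} \<Longrightarrow> reduces M (V k)"
begin

lemma invariant: "k \<in> {1..n} \<Longrightarrow> x \<in> M \<Longrightarrow> V k x \<in> M"
  and adj_invariant: "k \<in> {1..n} \<Longrightarrow> x \<in> M \<Longrightarrow> adj (V k) x \<in> M"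
  using red by (auto simp: reduces_def)

lemma row_proj_invariant: "x \<in> M \<Longrightarrow> row_proj x \<in> M"
  unfolding row_proj_def by (intro closed_csubspace_sum subspace invariant adj_invariant)

lemma row_isometry_on_M: "row_isometry_on M n V"
  using row invariant isometry_on_subset[OF isom] by (auto simp: row_isometry_on_def)

lemma reducing_orthocomp: "reducing_subspace n V (orthocomp M)"
  by unfold_locales (simp_all add: closed_csubspace_orthocomp reduces_orthocomp isom red)

text \<open>The inclusion from right to left holds because the coefficients
  \<open>adj (V k) x\<close> of a vector of \<open>M\<close> stay in \<open>M\<close>.\<close>

lemma row_range_eq: "row_range M n V m = M \<inter> row_range UNIV n V m"
proof (induction m)
  case (Suc m)
  show ?case
  proof (intro equalityI subsetI)
    fix x assume "x \<in> row_range M n V (Suc m)"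
    then obtain y where y: "\<forall>k\<in>{1..n}. y k \<in> M \<inter> row_range UNIV n V m"
      and x: "x = (\<Sum>k=1..n. V k (y k))"
      unfolding row_range_Suc Suc.IH by blast
    from y have "x \<in> M"
      unfolding x by (intro closed_csubspace_sum subspace invariant) auto
    moreover have "x \<in> row_range UNIV n V (Suc m)"
      using x y unfolding row_range_Suc by auto
    ultimately show "x \<in> M \<inter> row_range UNIV n V (Suc m)"
      by simp
  next
    fix x assume "x \<in> M \<inter> row_range UNIV n V (Suc m)"
    then have "x \<in> M" "row_proj x = x" "\<forall>k\<in>{1..n}. adj (V k) x \<in> M \<inter> row_range UNIV n V m"
      using adj_invariant by (auto simp: mem_row_range_Suc_iff)
    then show "x \<in> row_range M n V (Suc m)"
      unfolding row_range_Suc Suc.IH row_proj_def by (auto intro!: exI[of _ "\<lambda>k. adj (V k) x"])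
  qed
qed (simp add: row_range_0)

text \<open>The restricted adjoints agree with the global ones, so row unitarity says that
  \<open>row_proj\<close> fixes \<open>M\<close>; invariance under \<open>adj (V k)\<close> then
  makes \<open>subset_coreI\<close> applicable.\<close>

lemma row_unitary_iff: "row_unitary_on M n V \<longleftrightarrow> M \<subseteq> core"
proof -
  have "(\<Sum>k=1..n. V k (adjoint_on M (V k) x)) = row_proj x" if "x \<in> M" for x
    unfolding row_proj_def by (intro sum.cong HOL.refl) (simp add: adjoint_on_reducing[OF isom red] that)
  then have "row_unitary_on M n V \<longleftrightarrow> (\<forall>x\<in>M. row_proj x = x)"
    using row_isometry_on_M by (simp add: row_unitary_on_def)
  also have "\<dots> \<longleftrightarrow> M \<subseteq> core"
    using subset_coreI[of M] adj_invariant row_proj_core by blast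
  finally show ?thesis .
qed

text \<open>The projection onto \<open>M\<close> commutes with \<open>row_proj\<close> and with
  every \<open>adj (V k)\<close>, so the set of \<open>M\<close>-components of core vectors
  satisfies \<open>subset_coreI\<close>. Thus this projection preserves \<open>core\<close>.\<close>

lemma projection_mem_core:
  assumes p: "p \<in> M" and q: "q \<in> orthocomp M" and "p + q \<in> core"
  shows "p \<in> core"
proof -
  interpret c: reducing_subspace n V "orthocomp M"
    by (rule reducing_orthocomp)
  let ?C = "{p\<in>M. \<exists>q\<in>orthocomp M. p + q \<in> core}"
  have "?C \<subseteq> core"
  proof (rule subset_coreI)
    fix x assume "x \<in> ?C"
    then obtain y where x: "x \<in> M" and y: "y \<in> orthocomp M" and xy: "x + y \<in> core"
      by blast
    have "row_proj x + row_proj y = row_proj (x + y)"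
      by (simp add: row_proj_def adj_add iso_add isom sum.distrib)
    also have "\<dots> = x + y"
      using xy by (rule row_proj_core)
    finally show "row_proj x = x"
      by (rule orthogonal_sum_unique[OF subspace, rotated -1])
        (simp_all add: x y row_proj_invariant c.row_proj_invariant)
    show "adj (V k) x \<in> ?C" if k: "k \<in> {1..n}" for k
    proof -
      have "adj (V k) x + adj (V k) y \<in> core"
        using adj_core[OF xy k] by (simp add: adj_add isom[OF k])
      then show ?thesis
        using adj_invariant[OF k x] c.adj_invariant[OF k y] by blast
    qed
  qed
  then show ?thesis
    using assms by blast
qed

text \<open>Purity only says that \<open>M\<close> meets \<open>core\<close> in 0. The
  \<open>M\<close>-component of a core vector is in \<open>core\<close> by
  \<open>projection_mem_core\<close>, so it vanishes and the vector is orthogonal to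
  \<open>M\<close>.\<close>

lemma pure_row_isometry_iff: "pure_row_isometry_on M n V \<longleftrightarrow> M \<subseteq> orthocomp core"
proof -
  have "(\<Inter>m. row_range M n V m) = M \<inter> core"
    by (auto simp: row_range_eq core_def)
  then have "pure_row_isometry_on M n V \<longleftrightarrow> M \<inter> core = {0}"
    by (simp add: pure_row_isometry_on_def row_isometry_on_M)
  also have "\<dots> \<longleftrightarrow> M \<subseteq> orthocomp core"
  proof
    assume trivial: "M \<inter> core = {0}"
    have "cinner u m = 0" if u: "u \<in> core" and m: "m \<in> M" for u m
    proof -
      obtain p q where pq: "p \<in> M" "q \<in> orthocomp M" "u = p + q"
        using orthogonal_projection[OF subspace] .
      then have "p = 0"
        using projection_mem_core[of p q] u trivial by blast
      with pq m show ?thesis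
        by (simp add: orthocomp_cinner')
    qed
    then show "M \<subseteq> orthocomp core"
      by (auto simp: orthocomp_def)
  next
    assume "M \<subseteq> orthocomp core"
    then show "M \<inter> core = {0}"
      using orthocomp_Int_eq_0[of _ core] closed_csubspaceD(2)[OF subspace]
        closed_csubspaceD(2)[OF closed_csubspace_core] by blast
  qed
  finally show ?thesis .
qed

end

section \<open>A single isometry as a row of length one\<close>

context
  fixes W :: "'a::chilbert_space \<Rightarrow> 'a"
  assumes iso: "isometry_on UNIV W"
begin

lemma row_isometry_single: "row_isometry 1 (\<lambda>_. W)"
  by unfold_locales (simp add: row_isometry_on_def iso)

interpretation row_isometry 1 "\<lambda>_. W"
  by (rule row_isometry_single)

lemma row_range_single: "row_range M 1 (\<lambda>_. W) m = (W ^^ m) ` M"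
proof (induction m)
  case (Suc m)
  have "row_range M 1 (\<lambda>_. W) (Suc m) = W ` row_range M 1 (\<lambda>_. W) m"
    unfolding row_range_Suc by (auto intro: exI[of _ "\<lambda>_. x" for x])
  then show ?case
    by (simp add: Suc.IH image_image)
qed (simp add: row_range_0)

lemma reducing_subspace_single: "reduces M W \<Longrightarrow> reducing_subspace 1 (\<lambda>_. W) M"
  by unfold_locales (simp_all add: reduces_def)

lemma unitary_on_iff:
  assumes M: "reduces M W"
  shows "unitary_on M W \<longleftrightarrow> M \<subseteq> core"
proof -
  interpret reducing_subspace 1 "\<lambda>_. W" M
    by (rule reducing_subspace_single[OF M])
  have isoM: "isometry_on M W"
    using invariant by (intro isometry_on_subset[OF iso]) auto
  \<comment> \<open>Surjectivity of \<open>W\<close> on \<open>M\<close> means that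
    \<open>W (adj W x) = x\<close> there, which is row unitarity for a row of length one.\<close>
  have "unitary_on M W \<longleftrightarrow> (\<forall>x\<in>M. W (adj W x) = x)"
  proof
    assume "unitary_on M W"
    then show "\<forall>x\<in>M. W (adj W x) = x"
      using adj_iso[OF iso] by (metis imageE unitary_on_def)
  next
    assume "\<forall>x\<in>M. W (adj W x) = x"
    then have "W ` M = M"
      using invariant[of 1] adj_invariant[of 1] by (force simp: image_iff)
    with isoM show "unitary_on M W"
      by (simp add: unitary_on_def)
  qed
  also have "\<dots> \<longleftrightarrow> row_unitary_on M 1 (\<lambda>_. W)"
    using row_isometry_on_M by (simp add: row_unitary_on_def adjoint_on_reducing[OF iso M])
  finally show ?thesis
    by (simp only: row_unitary_iff)
qed

lemma pure_isometry_on_iff: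
  assumes M: "reduces M W"
  shows "pure_isometry_on M W \<longleftrightarrow> M \<subseteq> orthocomp core"
proof -
  interpret reducing_subspace 1 "\<lambda>_. W" M
    by (rule reducing_subspace_single[OF M])
  have "pure_isometry_on M W \<longleftrightarrow> pure_row_isometry_on M 1 (\<lambda>_. W)"
    by (simp add: pure_isometry_on_def pure_row_isometry_on_def row_range_single row_isometry_on_def)
  then show ?thesis
    by (simp only: pure_row_isometry_iff)
qed

end

section \<open>Coordinates with respect to an orthonormal basis\<close>

lemma nonneg_summable_on_Times_iff:
  fixes f :: "'j \<Rightarrow> 'x \<Rightarrow> real"
  assumes "\<And>j x. f j x \<ge> 0"
  shows "(\<lambda>(j, x). f j x) summable_on (J \<times> X) \<longleftrightarrow>
    (\<forall>j\<in>J. f j summable_on X) \<and> (\<lambda>j. \<Sum>\<^sub>\<infinity>x\<in>X. f j x) summable_on J"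
  using Infinite_Sum.abs_summable_on_Sigma_iff[where f = "\<lambda>(j, x). f j x" and A = J and B = "\<lambda>_. X"] assms
  by (simp add: infsum_nonneg case_prod_unfold)

text \<open>Coordinates in an orthonormal basis of \<open>M\<close>: totality gives injectivity,
  Riesz-Fischer gives surjectivity, and the Fourier expansion gives Parseval's identity.\<close>

lemma unitary_onto_copies_basis:
  fixes b :: "'j \<times> 'x \<Rightarrow> 'a::chilbert_space"
  assumes on: "orthonormal_on (J \<times> X) b" and M: "closed_csubspace M"
    and b: "\<And>j x. j \<in> J \<Longrightarrow> x \<in> X \<Longrightarrow> b (j, x) \<in> M"
    and total: "\<And>h. h \<in> M \<Longrightarrow> (\<And>j x. j \<in> J \<Longrightarrow> x \<in> X \<Longrightarrow> cinner (b (j, x)) h = 0) \<Longrightarrow> h = 0"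
  shows "unitary_onto_copies M J X (\<lambda>h j x. if j \<in> J \<and> x \<in> X then cinner (b (j, x)) h else 0)"
    (is "unitary_onto_copies M J X ?U")
proof -
  \<comment> \<open>Summability of the squares first over \<open>X\<close> and then over
    \<open>J\<close> is turned into summability over \<open>J \<times> X\<close>, where the basis is
    indexed.\<close>
  have copies_iff: "F \<in> ell2_copies J X \<longleftrightarrow> (\<forall>j x. (j, x) \<notin> J \<times> X \<longrightarrow> F j x = 0) \<and>
      (\<lambda>i. (cmod (F (fst i) (snd i)))\<^sup>2) summable_on (J \<times> X)" for F :: "'j \<Rightarrow> 'x \<Rightarrow> complex"
    using nonneg_summable_on_Times_iff[of "\<lambda>j x. (cmod (F j x))\<^sup>2" J X]
    by (auto simp: ell2_copies_def ell2_def case_prod_unfold fun_eq_iff)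
  have mem: "?U h \<in> ell2_copies J X" for h
  proof -
    have "(\<lambda>i. (cmod (?U h (fst i) (snd i)))\<^sup>2) summable_on (J \<times> X) \<longleftrightarrow>
        (\<lambda>i. (cmod (cinner (b i) h))\<^sup>2) summable_on (J \<times> X)"
      by (rule summable_on_cong) auto
    then show ?thesis
      using bessel_summable[OF on] by (auto simp: copies_iff)
  qed
  have "inj_on ?U M"
  proof (rule inj_onI)
    fix h k assume hk: "h \<in> M" "k \<in> M" and eq: "?U h = ?U k"
    have "h - k = 0"
    proof (rule total)
      show "h - k \<in> M"
        using M hk by (rule closed_csubspaceD(6))
      show "cinner (b (j, x)) (h - k) = 0" if "j \<in> J" "x \<in> X" for j x
        using fun_cong[OF fun_cong[OF eq, of j], of x] that by (simp add: cinner_diff_right)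
    qed
    then show "h = k"
      by simp
  qed
  moreover have "?U ` M = ell2_copies J X"
  proof (intro equalityI subsetI)
    fix F assume F: "F \<in> ell2_copies J X"
    define c where "c = (\<lambda>i. F (fst i) (snd i))"
    define h where "h = (\<Sum>\<^sub>\<infinity>i\<in>J \<times> X. c i *\<^sub>C b i)"
    have "h \<in> M"
      unfolding h_def using b by (intro closed_csubspace_infsum M closed_csubspaceD(4)[OF M]) auto
    moreover have "cinner (b i) h = c i" if "i \<in> J \<times> X" for i
      unfolding h_def using F that
      by (intro cinner_orthonormal_infsum[OF on]) (simp_all add: copies_iff c_def)
    then have "?U h = F"
      using F by (intro ext) (auto simp: copies_iff c_def)
    ultimately show "F \<in> ?U ` M"
      by blast
  qed (use mem in blast)
  ultimately have "bij_betw ?U M (ell2_copies J X)"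
    by (simp add: bij_betw_def)
  moreover have "ell2_copies_cinner J X (?U h) (?U k) = cinner h k" if "k \<in> M" for h k
  proof -
    have "(\<Sum>\<^sub>\<infinity>i\<in>J \<times> X. cinner (b i) k *\<^sub>C b i) = k"
      using b that total
      by (intro orthonormal_expansion[OF on M] closed_csubspace_infsum M closed_csubspaceD(4)[OF M]) auto
    then have "((\<lambda>i. cinner (b i) k *\<^sub>C b i) has_sum k) (J \<times> X)"
      using has_sum_infsum[OF orthonormal_summable[OF on bessel_summable[OF on]], of k] by simp
    \<comment> \<open>The continuous functional \<open>cinner h\<close> is applied termwise to the
      Fourier expansion of \<open>k\<close>; summability over the product then permits iterated
      summation.\<close>
    then have "((\<lambda>i. cinner h (cinner (b i) k *\<^sub>C b i)) has_sum cinner h k) (J \<times> X)"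
      by (rule has_sum_bounded_linear[OF bounded_linear_cinner_right])
    also have "?this \<longleftrightarrow> ((\<lambda>(j, x). cnj (?U h j x) * ?U k j x) has_sum cinner h k) (J \<times> X)"
      by (rule has_sum_cong) (auto simp: cinner_scaleC_right cinner_commute[of h])
    finally have sum: "((\<lambda>(j, x). cnj (?U h j x) * ?U k j x) has_sum cinner h k) (J \<times> X)" .
    have "ell2_copies_cinner J X (?U h) (?U k) =
        (\<Sum>\<^sub>\<infinity>(j, x)\<in>J \<times> X. cnj (?U h j x) * ?U k j x)"
      unfolding ell2_copies_cinner_def ell2_cinner_def
      by (rule infsum_Sigma'_banach) (rule has_sum_imp_summable[OF sum])
    also have "\<dots> = cinner h k"
      by (rule infsumI[OF sum])
    finally show ?thesis .
  qed
  ultimately show ?thesis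
    unfolding unitary_onto_copies_def
    by (simp add: cinner_add_right cinner_scaleC_right fun_eq_iff)
qed

section \<open>Normal forms in the odometer semigroup\<close>

text \<open>Universal property of the presentation: maps that satisfy the defining relations give a
  well-defined action. It serves for the representation itself and for the counting actions
  \<open>odo_affine\<close> and \<open>odo_degree\<close>.\<close>

lemma odo_cong_foldr:
  assumes cong: "odo_cong n l l'"
    and step: "\<And>k. 1 \<le> k \<Longrightarrow> k + 1 \<le> n \<Longrightarrow> f GenW \<circ> f (GenV k) = f (GenV (k + 1))"
    and carry: "f GenW \<circ> f (GenV n) = f (GenV 1) \<circ> f GenW"
  shows "foldr f l = foldr f l'"
  using cong
proof induction
  case (rel_step k)
  then show ?case
    using step by simp
next
  case rel_carry
  then show ?case
    using carry by simp
qed (simp_all add: foldr_append)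

lemma odo_cong_Cons: "odo_cong n l l' \<Longrightarrow> odo_cong n (g # l) (g # l')"
  using odo_cong.in_context[of n l l' "[g]" "[]"] by simp

lemma odo_cong_GenW_GenV:
  "1 \<le> k \<Longrightarrow> k < n \<Longrightarrow> odo_cong n (GenW # GenV k # l) (GenV (k + 1) # l)"
  "odo_cong n (GenW # GenV n # l) (GenV 1 # GenW # l)"
  using odo_cong_append[OF odo_cong.rel_step odo_cong.refl, of k n l]
    odo_cong_append[OF odo_cong.rel_carry odo_cong.refl, of n l] by simp_all

definition odo_nf :: "nat list \<Rightarrow> nat \<Rightarrow> odo_gen list" where
  "odo_nf \<mu> N = map GenV \<mu> @ replicate N GenW"

lemma odo_nf_simps [simp]:
  "odo_nf (k # \<mu>) N = GenV k # odo_nf \<mu> N" "odo_nf [] (Suc N) = GenW # odo_nf [] N"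
  "odo_nf [] 0 = []"
  by (simp_all add: odo_nf_def)

lemma odo_words_Cons [simp]:
  "GenV k # l \<in> odo_words n \<longleftrightarrow> k \<in> {1..n} \<and> l \<in> odo_words n"
  "GenW # l \<in> odo_words n \<longleftrightarrow> l \<in> odo_words n" "[] \<in> odo_words n"
  by (auto simp: odo_words_def)

lemma odo_nf_words: "set \<mu> \<subseteq> {1..n} \<Longrightarrow> odo_nf \<mu> N \<in> odo_words n"
  by (induction \<mu>; induction N) auto

text \<open>Adding one with carry: \<open>w\<close> raises a first letter below \<open>n\<close> and
  is absorbed, while a first letter \<open>n\<close> becomes 1 and \<open>w\<close> moves on. Past
  the last letter it increases \<open>N\<close>.\<close>

lemma odo_cong_GenW_nf:
  assumes "set \<mu> \<subseteq> {1..n}"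
  shows "\<exists>\<mu>' N'. set \<mu>' \<subseteq> {1..n} \<and> odo_cong n (GenW # odo_nf \<mu> N) (odo_nf \<mu>' N')"
  using assms
proof (induction \<mu>)
  case Nil
  have "odo_cong n (GenW # odo_nf [] N) (odo_nf [] (Suc N))"
    by (simp add: odo_cong.refl)
  then show ?case
    by (metis Nil)
next
  case (Cons k \<mu>)
  show ?case
  proof (cases "k = n")
    case False
    then have "odo_cong n (GenW # odo_nf (k # \<mu>) N) (odo_nf ((k + 1) # \<mu>) N)"
      using Cons.prems odo_cong_GenW_GenV(1)[of k n "odo_nf \<mu> N"] by simp
    moreover have "set ((k + 1) # \<mu>) \<subseteq> {1..n}"
      using Cons.prems False by simp
    ultimately show ?thesis
      by blast
  next
    case True
    obtain \<mu>' N' where IH: "set \<mu>' \<subseteq> {1..n}" "odo_cong n (GenW # odo_nf \<mu> N) (odo_nf \<mu>' N')"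
      using Cons by auto
    have "odo_cong n (GenW # odo_nf (k # \<mu>) N) (GenV 1 # GenW # odo_nf \<mu> N)"
      using True odo_cong_GenW_GenV(2) by simp
    also have "odo_cong n (GenV 1 # GenW # odo_nf \<mu> N) (odo_nf (1 # \<mu>') N')"
      using odo_cong_Cons[OF IH(2)] by simp
    finally (odo_cong.trans) have "odo_cong n (GenW # odo_nf (k # \<mu>) N) (odo_nf (1 # \<mu>') N')" .
    moreover have "set (1 # \<mu>') \<subseteq> {1..n}"
      using IH(1) Cons.prems by auto
    ultimately show ?thesis
      by blast
  qed
qed

lemma odo_normal_form:
  assumes "l \<in> odo_words n"
  obtains \<mu> N where "set \<mu> \<subseteq> {1..n}" "odo_cong n l (odo_nf \<mu> N)"
proof -
  have "\<exists>\<mu> N. set \<mu> \<subseteq> {1..n} \<and> odo_cong n l (odo_nf \<mu> N)"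
    using assms
  proof (induction l)
    case Nil
    have "odo_cong n [] (odo_nf [] 0)"
      by (simp add: odo_cong.refl)
    then show ?case
      by (metis empty_set empty_subsetI)
  next
    case (Cons g l)
    then have "l \<in> odo_words n"
      by (simp add: odo_words_def)
    then obtain \<mu> N where IH: "set \<mu> \<subseteq> {1..n}" "odo_cong n l (odo_nf \<mu> N)"
      using Cons.IH by blast
    then have step: "odo_cong n (g # l) (g # odo_nf \<mu> N)"
      by (simp add: odo_cong_Cons)
    show ?case
    proof (cases g)
      case (GenV k)
      then have "odo_cong n (g # l) (odo_nf (k # \<mu>) N)" "set (k # \<mu>) \<subseteq> {1..n}"
        using step IH(1) Cons.prems by auto
      then show ?thesis
        by blast
    next
      case GenW
      then show ?thesis
        using odo_cong_GenW_nf[OF IH(1), of N] step by (metis odo_cong.trans)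
    qed
  qed
  then show ?thesis
    using that by blast
qed

lemma odometer_carrier: "carrier (odometer n) = odo_class n ` odo_words n"
  by (simp add: odometer_def)

lemma odo_carrier_normal_form:
  assumes "x \<in> carrier (odometer n)"
  obtains \<mu> N where "set \<mu> \<subseteq> {1..n}" "x = odo_class n (odo_nf \<mu> N)"
proof -
  obtain l where "l \<in> odo_words n" "x = odo_class n l"
    using assms by (auto simp: odometer_carrier)
  then show ?thesis
    using odo_normal_form[of l n] odo_class_eq that by metis
qed

section \<open>Purity of the left regular representation\<close>

text \<open>
  Each generator strictly raises a monotone quantity \<open>c\<close> that is constant on the classes of words.
  So a vector in the range of every power of that generator has coefficients supported on elements
  with arbitrarily large \<open>c\<close>, hence is zero.
\<close>

definition high_support ::
    "(odo_gen list \<Rightarrow> nat) \<Rightarrow> nat \<Rightarrow> (odo_gen list set \<Rightarrow> complex) \<Rightarrow> bool" where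
  "high_support c m F \<longleftrightarrow> (\<forall>y. F y \<noteq> 0 \<longrightarrow> (\<forall>l\<in>y. m \<le> c l))"

text \<open>A nonzero coefficient of the image at \<open>y\<close> requires some \<open>x\<close>
  with \<open>g x = y\<close> and a nonzero coefficient, and passing from a word of \<open>x\<close>
  to one of \<open>y\<close> raises \<open>c\<close>.\<close>

lemma high_support_left_regular:
  assumes c: "\<And>l l'. odo_cong n l l' \<Longrightarrow> c l = c l'" and g: "[g] \<in> odo_words n"
    and grow: "\<And>l. c l < c (g # l)" and F: "high_support c m F"
  shows "high_support c (Suc m) (left_regular (odometer n) (odo_class n [g]) F)"
  unfolding high_support_def
proof (intro allI impI ballI)
  fix y l
  assume nz: "left_regular (odometer n) (odo_class n [g]) F y \<noteq> 0" and l: "l \<in> y"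
  have "\<exists>x\<in>carrier (odometer n). odo_class n [g] \<otimes>\<^bsub>odometer n\<^esub> x = y \<and> F x \<noteq> 0"
  proof (rule ccontr)
    assume "\<not> ?thesis"
    then have "left_regular (odometer n) (odo_class n [g]) F y = 0"
      unfolding left_regular_def by (intro infsum_0) auto
    with nz show False
      by simp
  qed
  then obtain l0 where l0: "l0 \<in> odo_words n" and y: "odo_class n ([g] @ l0) = y"
    and "F (odo_class n l0) \<noteq> 0"
    using g by (auto simp: odometer_carrier odo_mult_class)
  then have "m \<le> c l0"
    using F by (auto simp: high_support_def odo_class_def odo_cong.refl)
  also have "c l0 < c (g # l0)"
    by (rule grow)
  also have "c (g # l0) = c l"
    using l y by (intro c) (auto simp: odo_class_def)
  finally show "Suc m \<le> c l"
    by simp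
qed

lemma high_support_sum:
  assumes "\<And>k. k \<in> K \<Longrightarrow> high_support c m (F k)"
  shows "high_support c m (\<lambda>y. \<Sum>k\<in>K. F k y)"
  using assms unfolding high_support_def by (metis sum.neutral)

lemma all_high_support_imp_0:
  assumes "F \<in> ell2 (carrier (odometer n))" "\<And>m. high_support c m F"
  shows "F y = 0"
proof (rule ccontr)
  assume nz: "F y \<noteq> 0"
  \<comment> \<open>Support in the carrier supplies a word \<open>l\<close> in \<open>y\<close>;
    high support for the bound \<open>Suc (c l)\<close> is then violated by
    \<open>l\<close>.\<close>
  then obtain l where "y = odo_class n l" "l \<in> odo_words n"
    using assms(1) by (auto simp: ell2_def odometer_carrier)
  then have "l \<in> y"
    by (simp add: odo_class_def odo_cong.refl)
  then have "Suc (c l) \<le> c l"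
    using assms(2)[of "Suc (c l)"] nz by (auto simp: high_support_def)
  then show False
    by simp
qed

text \<open>The semigroup acts on the natural numbers by \<open>v\<^sub>k a = n a + k - 1\<close> and \<open>w a = a + 1\<close>.\<close>

fun odo_affine :: "nat \<Rightarrow> odo_gen \<Rightarrow> nat \<Rightarrow> nat" where
  "odo_affine n (GenV k) a = n * a + (k - 1)"
| "odo_affine n GenW a = Suc a"

text \<open>The carry relation amounts to \<open>n * a + (n - 1) + 1 = n * (a + 1)\<close>, where
  \<open>n \<ge> 1\<close> makes the truncated subtraction exact.\<close>

lemma odo_cong_affine:
  assumes "n \<ge> 1" "odo_cong n l l'"
  shows "foldr (odo_affine n) l = foldr (odo_affine n) l'"
  by (rule odo_cong_foldr[OF assms(2)]) (use assms(1) in \<open>auto simp: fun_eq_iff\<close>)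

text \<open>Counts the letters \<open>v\<^sub>k\<close> of a word. It grows under every
  \<open>v\<^sub>k\<close>, where the affine action can stand still: there \<open>v\<^sub>1\<close>
  fixes 0.\<close>

fun odo_degree :: "odo_gen \<Rightarrow> nat \<Rightarrow> nat" where
  "odo_degree (GenV k) a = Suc a"
| "odo_degree GenW a = a"

lemma odo_cong_degree:
  assumes "odo_cong n l l'"
  shows "foldr odo_degree l = foldr odo_degree l'"
  by (rule odo_cong_foldr[OF assms]) (auto simp: fun_eq_iff)

section \<open>Isometric Nica-covariant representations\<close>

lemma sum_split_first: "1 \<le> m \<Longrightarrow> (\<Sum>k=1..m. f k) = f 1 + (\<Sum>k=1..<m. f (k + 1))"
  and sum_split_last: "1 \<le> m \<Longrightarrow> (\<Sum>k=1..m. f k) = f m + (\<Sum>k=1..<m. f k)"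
  for f :: "nat \<Rightarrow> 'b::comm_monoid_add"
  by (induction m rule: nat_induct_at_least) (simp_all add: ac_simps flip: Suc_eq_plus1)

locale odometer_rep = row_isometry n V
  for n :: nat and V :: "nat \<Rightarrow> 'a::chilbert_space \<Rightarrow> 'a" and W :: "'a \<Rightarrow> 'a" +
  assumes n: "n \<ge> 1" and isoW: "isometry_on UNIV W"
    and W_V: "1 \<le> k \<Longrightarrow> k < n \<Longrightarrow> W (V k x) = V (k + 1) x"
    and W_V_n: "W (V n x) = V 1 (W x)"
    and adjW_V_1: "adj W (V 1 x) = V n (adj W x)"
begin

sublocale w: row_isometry 1 "\<lambda>_. W"
  by (rule row_isometry_single[OF isoW])

section \<open>Commutation of the adjoints with \<open>W\<close> and the \<open>V k\<close>\<close>

lemma n_mem: "1 \<in> {1..n}" "n \<in> {1..n}"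
  using n by auto

lemma adjW_V: "1 \<le> k \<Longrightarrow> k < n \<Longrightarrow> adj W (V (k + 1) x) = V k x"
  by (metis W_V adj_iso isoW)

text \<open>The adjoint of Nica covariance. With the next three relations it tells how
  \<open>adj (V k)\<close> passes \<open>W\<close> and \<open>adj W\<close>: the index shifts
  cyclically, and \<open>W\<close> or \<open>adj W\<close> survives only at the wrap-around.\<close>

lemma adjV_1_W: "adj (V 1) (W x) = W (adj (V n) x)"
  by (rule cinner_ext)
    (simp add: cinner_adj[OF isom, symmetric] cinner_adj'[OF isoW] n adjW_V_1)

lemma adjV_W: "1 \<le> k \<Longrightarrow> k < n \<Longrightarrow> adj (V (k + 1)) (W x) = adj (V k) x"
  by (rule cinner_ext)
    (simp add: cinner_adj[OF isom, symmetric] cinner_adj'[OF isoW] adjW_V)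

lemma adjV_n_adjW: "adj (V n) (adj W x) = adj W (adj (V 1) x)"
  by (rule cinner_ext)
    (simp add: cinner_adj[OF isom, symmetric] cinner_adj[OF isoW, symmetric] n W_V_n)

lemma adjV_adjW: "1 \<le> k \<Longrightarrow> k < n \<Longrightarrow> adj (V k) (adj W x) = adj (V (k + 1)) x"
  by (rule cinner_ext)
    (simp add: cinner_adj[OF isom, symmetric] cinner_adj[OF isoW, symmetric] W_V)

section \<open>Both cores reduce the whole family\<close>

lemma index_cases:
  assumes "k \<in> {1..n}"
  obtains "k = 1" | j where "k = j + 1" "1 \<le> j" "j < n"
proof (cases "k = 1")
  case False
  with assms that(2)[of "k - 1"] show ?thesis
    by auto
qed (rule that(1))

text \<open>\<open>W\<close> turns the term of index \<open>k\<close> into that of index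
  \<open>k + 1\<close> and wraps from \<open>n\<close> to 1, so the sums agree after splitting off
  the first index on one side and the last on the other.\<close>

lemma row_proj_W: "row_proj (W x) = W (row_proj x)"
proof -
  have "row_proj (W x) = V 1 (W (adj (V n) x)) + (\<Sum>k\<in>{1..<n}. V (k + 1) (adj (V k) x))"
    unfolding row_proj_def sum_split_first[OF n] by (simp add: adjV_1_W adjV_W)
  also have "\<dots> = W (V n (adj (V n) x)) + (\<Sum>k\<in>{1..<n}. W (V k (adj (V k) x)))"
    by (simp add: W_V_n W_V)
  also have "\<dots> = W (row_proj x)"
    unfolding row_proj_def sum_split_last[OF n] by (simp add: iso_add[OF isoW] iso_sum[OF isoW])
  finally show ?thesis .
qed

lemma cinner_row_proj: "cinner (row_proj x) y = cinner x (row_proj y)"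
  unfolding row_proj_def cinner_sum_left cinner_sum_right
  by (intro sum.cong HOL.refl) (simp add: cinner_adj[OF isom] cinner_adj'[OF isom])

lemma row_proj_adjW: "row_proj (adj W x) = adj W (row_proj x)"
  by (rule cinner_ext)
    (simp add: cinner_row_proj[symmetric] cinner_adj[OF isoW, symmetric] row_proj_W)

lemma reduces_core_W: "reduces core W"
proof -
  have "W ` core \<subseteq> core"
  proof -
    \<comment> \<open>Passing \<open>adj (V k)\<close> through \<open>W\<close> keeps
      \<open>W\<close> for index 1 and absorbs it otherwise; joining the image with
      \<open>core\<close> itself gives a stable set.\<close>
    have "W ` core \<union> core \<subseteq> core"
    proof (rule subset_coreI)
      show "row_proj x = x" if "x \<in> W ` core \<union> core" for x
        using that by (auto simp: row_proj_W row_proj_core)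
      fix k x assume k: "k \<in> {1..n}" and x: "x \<in> W ` core \<union> core"
      show "adj (V k) x \<in> W ` core \<union> core"
        using k
      proof (cases rule: index_cases)
        case 1
        then show ?thesis
          using x n_mem by (auto simp: adjV_1_W adj_core)
      next
        case (2 j)
        then show ?thesis
          using x k by (auto simp: adjV_W adj_core)
      qed
    qed
    then show ?thesis
      by blast
  qed
  moreover have "adj W ` core \<subseteq> core"
  proof -
    \<comment> \<open>The same enlargement, with the wrap-around now at index
      \<open>n\<close>.\<close>
    have "adj W ` core \<union> core \<subseteq> core"
    proof (rule subset_coreI)
      show "row_proj x = x" if "x \<in> adj W ` core \<union> core" for x
        using that by (auto simp: row_proj_adjW row_proj_core)
      fix k x assume k: "k \<in> {1..n}" and x: "x \<in> adj W ` core \<union> core"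
      show "adj (V k) x \<in> adj W ` core \<union> core"
      proof (cases "k = n")
        case True
        then show ?thesis
          using x n_mem by (auto simp: adjV_n_adjW adj_core)
      next
        case False
        then show ?thesis
          using x k by (auto simp: adjV_adjW adj_core)
      qed
    qed
    then show ?thesis
      by blast
  qed
  ultimately show ?thesis
    by (auto simp: reduces_def closed_csubspace_core)
qed

lemma w_row_proj: "w.row_proj x = W (adj W x)"
  by (simp add: w.row_proj_def)

lemma w_core: "x \<in> w.core \<Longrightarrow> W (adj W x) = x" "x \<in> w.core \<Longrightarrow> adj W x \<in> w.core"
  using w.row_proj_core[of x] w.adj_core[of x 1] by (simp_all add: w_row_proj)

lemma subset_w_coreI:
  assumes "\<And>x. x \<in> M \<Longrightarrow> W (adj W x) = x" "\<And>x. x \<in> M \<Longrightarrow> adj W x \<in> M"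
  shows "M \<subseteq> w.core"
  using assms by (intro w.subset_coreI) (simp_all add: w_row_proj)

lemma reduces_w_core_W: "reduces w.core W"
  using w.reduces_core[of 1] by simp

lemma V_w_core:
  assumes "k \<in> {1..n}" "x \<in> w.core"
  shows "V k x \<in> w.core"
proof -
  \<comment> \<open>\<open>adj W\<close> lowers the index and wraps from 1 to \<open>n\<close>, so
    the union of the images over all \<open>k\<close> is stable.\<close>
  have "(\<Union>k\<in>{1..n}. V k ` w.core) \<subseteq> w.core"
  proof (rule subset_w_coreI)
    fix x assume "x \<in> (\<Union>k\<in>{1..n}. V k ` w.core)"
    then obtain k y where k: "k \<in> {1..n}" and y: "y \<in> w.core" and x: "x = V k y"
      by blast
    have "W (adj W x) = x \<and> adj W x \<in> (\<Union>k\<in>{1..n}. V k ` w.core)"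
      using k
    proof (cases rule: index_cases)
      case 1
      then show ?thesis
        using w_core[OF y] n_mem by (auto simp: x adjW_V_1 W_V_n)
    next
      case (2 j)
      then show ?thesis
        using y k by (auto simp: x adjW_V W_V)
    qed
    then show "W (adj W x) = x" "adj W x \<in> (\<Union>k\<in>{1..n}. V k ` w.core)"
      by blast+
  qed
  with assms show ?thesis
    by blast
qed

text \<open>Since \<open>adj (V (k + 1)) y = adj (V k) (adj W y)\<close> and \<open>adj W\<close>
  preserves \<open>w.core\<close>, the index can be lowered to 1.\<close>

lemma adjV_w_core_subset: "k \<in> {1..n} \<Longrightarrow> y \<in> w.core \<Longrightarrow> adj (V k) y \<in> adj (V 1) ` w.core"
proof (induction k arbitrary: y)
  case (Suc k)
  show ?case
  proof (cases "k = 0")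
    case True
    then show ?thesis
      using Suc.prems by (simp add: One_nat_def)
  next
    case False
    then have "adj (V (Suc k)) y = adj (V k) (adj W y)"
      using Suc.prems adjV_adjW[of k y] unfolding Suc_eq_plus1 by simp
    then show ?thesis
      using Suc.IH[of "adj W y"] Suc.prems False w_core(2) by simp
  qed
qed simp

text \<open>For \<open>x = adj (V 1) y\<close> the relations give
  \<open>adj W x = adj (V n) (adj W y)\<close>, which \<open>adjV_w_core_subset\<close> returns to
  the same set, and \<open>W (adj W x) = adj (V 1) (W (adj W y)) = x\<close>.\<close>

lemma adjV_w_core:
  assumes "k \<in> {1..n}" "x \<in> w.core"
  shows "adj (V k) x \<in> w.core"
proof -
  have "adj (V 1) ` w.core \<subseteq> w.core"
  proof (rule subset_w_coreI)
    fix x assume "x \<in> adj (V 1) ` w.core"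
    then obtain y where y: "y \<in> w.core" and x: "x = adj (V 1) y"
      by blast
    have eq: "adj W x = adj (V n) (adj W y)"
      by (simp add: x adjV_n_adjW)
    show "W (adj W x) = x"
      unfolding eq by (simp add: adjV_1_W[symmetric] w_core(1)[OF y] x)
    show "adj W x \<in> adj (V 1) ` w.core"
      unfolding eq by (intro adjV_w_core_subset n_mem w_core(2) y)
  qed
  with adjV_w_core_subset[OF assms] show ?thesis
    by blast
qed

lemma reduces_w_core_V: "k \<in> {1..n} \<Longrightarrow> reduces w.core (V k)"
  by (simp add: reduces_def w.closed_csubspace_core V_w_core adjV_w_core)

section \<open>The shift part and the operators of semigroup elements\<close>

definition shift_part :: "'a set" where
  "shift_part = orthocomp w.core \<inter> orthocomp core"

lemma reduces_shift_part: "reduces shift_part W" "k \<in> {1..n} \<Longrightarrow> reduces shift_part (V k)"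
  by (simp_all add: shift_part_def reduces_Int reduces_orthocomp isoW isom reduces_core_W
      reduces_w_core_W reduces_w_core_V reduces_core)

lemma shift_part_subspace: "closed_csubspace shift_part"
  using reduces_shift_part(1) by (simp add: reduces_def)

lemma shift_part_invariant:
  "x \<in> shift_part \<Longrightarrow> W x \<in> shift_part" "x \<in> shift_part \<Longrightarrow> adj W x \<in> shift_part"
  "k \<in> {1..n} \<Longrightarrow> x \<in> shift_part \<Longrightarrow> V k x \<in> shift_part" "k \<in> {1..n} \<Longrightarrow> x \<in> shift_part \<Longrightarrow> adj (V k) x \<in> shift_part"
  using reduces_shift_part by (auto simp: reduces_def)

definition opr :: "odo_gen \<Rightarrow> 'a \<Rightarrow> 'a" where
  "opr g = (case g of GenV k \<Rightarrow> V k | GenW \<Rightarrow> W)"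

lemma opr_simps [simp]: "opr (GenV k) = V k" "opr GenW = W"
  by (simp_all add: opr_def)

lemma opr_cong: "odo_cong n l l' \<Longrightarrow> foldr opr l = foldr opr l'"
  by (rule odo_cong_foldr) (auto simp: fun_eq_iff W_V W_V_n)

lemma iso_opr: "[g] \<in> odo_words n \<Longrightarrow> isometry_on UNIV (opr g)"
  by (cases g) (simp_all add: isoW isom)

text \<open>The operator of a semigroup element, read off from an arbitrarily chosen word of its
  class; \<open>opr_cong\<close> makes the choice irrelevant.\<close>

definition rep :: "odo_gen list set \<Rightarrow> 'a \<Rightarrow> 'a" where
  "rep x = foldr opr (SOME l. l \<in> x)"

lemma rep_class:
  assumes "l \<in> odo_words n"
  shows "rep (odo_class n l) = foldr opr l"
proof -
  have "l \<in> odo_class n l"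
    using assms by (simp add: odo_class_def odo_cong.refl)
  then have "(SOME l'. l' \<in> odo_class n l) \<in> odo_class n l"
    by (rule someI)
  then show ?thesis
    unfolding rep_def by (intro opr_cong[symmetric]) (simp add: odo_class_def)
qed

lemma rep_mult:
  assumes "[g] \<in> odo_words n" "x \<in> carrier (odometer n)"
  shows "rep (odo_class n [g] \<otimes>\<^bsub>odometer n\<^esub> x) h = opr g (rep x h)"
    "odo_class n [g] \<otimes>\<^bsub>odometer n\<^esub> x \<in> carrier (odometer n)"
proof -
  obtain l where l: "l \<in> odo_words n" "x = odo_class n l"
    using assms(2) by (auto simp: odometer_carrier)
  have "g # l \<in> odo_words n"
    using odo_words_append[OF assms(1) l(1)] by simp
  with l assms(1) show "rep (odo_class n [g] \<otimes>\<^bsub>odometer n\<^esub> x) h = opr g (rep x h)"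
    "odo_class n [g] \<otimes>\<^bsub>odometer n\<^esub> x \<in> carrier (odometer n)"
    by (simp_all add: odo_mult_class rep_class odometer_carrier)
qed

lemma rep_shift_part: "x \<in> carrier (odometer n) \<Longrightarrow> h \<in> shift_part \<Longrightarrow> rep x h \<in> shift_part"
proof -
  have "foldr opr l h \<in> shift_part" if "l \<in> odo_words n" "h \<in> shift_part" for l h
    using that
  proof (induction l)
    case (Cons g l)
    then show ?case
      by (cases g) (simp_all add: shift_part_invariant)
  qed simp
  then show "x \<in> carrier (odometer n) \<Longrightarrow> h \<in> shift_part \<Longrightarrow> rep x h \<in> shift_part"
    by (auto simp: odometer_carrier rep_class)
qed

section \<open>Wandering vectors and the orthonormal basis they generate\<close>

definition wandering :: "'a set" where
  "wandering = {h \<in> shift_part. adj W h = 0 \<and> (\<forall>k\<in>{1..n}. adj (V k) h = 0)}"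

lemma wandering_scaleC: "h \<in> wandering \<Longrightarrow> c *\<^sub>C h \<in> wandering"
  using closed_csubspaceD(4)[OF shift_part_subspace] by (simp add: wandering_def adj_scaleC isoW isom)

text \<open>Moving \<open>adj (V k)\<close> past a factor \<open>W\<close> either absorbs that
  factor or pulls it out in front and leaves \<open>adj (V n)\<close>; after \<open>N\<close> steps
  the adjoint meets \<open>h\<close>, which it kills.\<close>

lemma adjV_nf_Nil:
  assumes "h \<in> wandering"
  shows "k \<in> {1..n} \<Longrightarrow> adj (V k) (foldr opr (odo_nf [] N) h) = 0"
proof (induction N arbitrary: k)
  case (Suc N)
  from Suc.prems show ?case
  proof (cases rule: index_cases)
    case 1
    then show ?thesis
      using Suc.IH[OF n_mem(2)] by (simp add: adjV_1_W iso_zero[OF isoW])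
  next
    case (2 j)
    then show ?thesis
      using Suc.IH[of j] by (simp add: adjV_W)
  qed
qed (use assms in \<open>simp add: wandering_def\<close>)

text \<open>Equal first letters cancel, different ones have orthogonal ranges, a letter against a
  power of \<open>W\<close> gives 0 by \<open>adjV_nf_Nil\<close>, and unequal powers of
  \<open>W\<close> reduce to \<open>adj W e = 0\<close> or \<open>adj W e' = 0\<close>.\<close>

lemma cinner_nf:
  assumes "e \<in> wandering" "e' \<in> wandering"
  shows "set \<mu> \<subseteq> {1..n} \<Longrightarrow> set \<mu>' \<subseteq> {1..n} \<Longrightarrow>
    cinner (foldr opr (odo_nf \<mu> N) e) (foldr opr (odo_nf \<mu>' N') e') =
      (if \<mu> = \<mu>' \<and> N = N' then cinner e e' else 0)"
proof (induction \<mu> arbitrary: \<mu>')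
  case Nil
  show ?case
  proof (cases \<mu>')
    case (Cons k \<nu>)
    then show ?thesis
      using Nil adjV_nf_Nil[OF assms(1), of k N] by (simp add: cinner_adj'[OF isom])
  next
    case empty: Nil
    have "cinner (foldr opr (odo_nf [] N) e) (foldr opr (odo_nf [] N') e') =
        (if N = N' then cinner e e' else 0)"
    proof (induction N arbitrary: N')
      case 0
      then show ?case
        using assms(1) by (cases N') (simp_all add: cinner_adj'[OF isoW] wandering_def)
    next
      case (Suc N)
      note IH = Suc.IH
      show ?case
      proof (cases N')
        case 0
        then show ?thesis
          using assms(2) by (simp add: cinner_adj[OF isoW] wandering_def)
      next
        case (Suc M)
        then show ?thesis
          by (simp add: iso_cinner[OF isoW] IH)
      qed
    qed
    with empty show ?thesis
      by simp
  qed
next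
  case (Cons k \<mu>)
  show ?case
  proof (cases \<mu>')
    case Nil
    then show ?thesis
      using Cons.prems adjV_nf_Nil[OF assms(2), of k N'] by (simp add: cinner_adj[OF isom])
  next
    case (Cons k' \<nu>)
    then show ?thesis
      using Cons.prems Cons.IH[of \<nu>] by (auto simp: cinner_adj[OF isom] adj_row)
  qed
qed

lemma orthonormal_rep:
  assumes J: "J \<subseteq> wandering" "orthonormal_on J (\<lambda>x. x)"
  shows "orthonormal_on (J \<times> carrier (odometer n)) (\<lambda>(j, x). rep x j)"
proof -
  have "cinner (rep x j) (rep x' j') = (if j = j' \<and> x = x' then 1 else 0)"
    if j: "j \<in> J" "j' \<in> J" and x: "x \<in> carrier (odometer n)" "x' \<in> carrier (odometer n)" for j j' x x'
  proof -
    obtain \<mu> N where \<mu>: "set \<mu> \<subseteq> {1..n}" "x = odo_class n (odo_nf \<mu> N)"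
      using odo_carrier_normal_form[OF x(1)] .
    obtain \<mu>' N' where \<mu>': "set \<mu>' \<subseteq> {1..n}" "x' = odo_class n (odo_nf \<mu>' N')"
      using odo_carrier_normal_form[OF x(2)] .
    have eq: "cinner (rep x j) (rep x' j') = (if \<mu> = \<mu>' \<and> N = N' then cinner j j' else 0)"
      using J(1) j \<mu> \<mu>' by (simp add: rep_class odo_nf_words cinner_nf subset_iff)
    \<comment> \<open>Norm one makes the normal form unique: the same element with two different
      data \<open>\<mu>\<close>, \<open>N\<close> would give inner product 0 with itself.\<close>
    have self: "cinner (rep x j) (rep x j) = 1"
      using J j \<mu> by (simp add: rep_class odo_nf_words cinner_nf subset_iff orthonormal_on_def)
    show ?thesis
    proof (cases "\<mu> = \<mu>' \<and> N = N'")
      case True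
      then show ?thesis
        using eq J(2) j \<mu> \<mu>' by (auto simp: orthonormal_on_def)
    next
      case False
      then show ?thesis
        using eq self by auto
    qed
  qed
  then show ?thesis
    by (auto simp: orthonormal_on_def)
qed

text \<open>A two-step elimination. Maximality of \<open>J\<close> puts \<open>Q\<close> inside
  \<open>w.core\<close>, and \<open>Q\<close> is orthogonal to \<open>w.core\<close>, so
  \<open>Q\<close> is trivial. The defects \<open>x - row_proj x\<close> of vectors of
  \<open>K\<close> lie in \<open>Q\<close>, so \<open>K\<close> is inside \<open>core\<close> and,
  being orthogonal to it, trivial too.\<close>

lemma rep_total:
  assumes J: "J \<subseteq> wandering"
    and max: "\<And>x. x \<in> wandering \<Longrightarrow> (\<And>j. j \<in> J \<Longrightarrow> cinner j x = 0) \<Longrightarrow> x = 0"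
    and h: "h \<in> shift_part" and ortho: "\<And>j x. j \<in> J \<Longrightarrow> x \<in> carrier (odometer n) \<Longrightarrow> cinner (rep x j) h = 0"
  shows "h = 0"
proof -
  define K where "K = {h \<in> shift_part. \<forall>j\<in>J. \<forall>l\<in>odo_words n. cinner (foldr opr l j) h = 0}"
  define Q where "Q = {q \<in> K. \<forall>k\<in>{1..n}. adj (V k) q = 0}"
  have "Q \<subseteq> w.core"
  proof (rule subset_w_coreI)
    fix q assume "q \<in> Q"
    then have q: "q \<in> shift_part" "\<And>k. k \<in> {1..n} \<Longrightarrow> adj (V k) q = 0"
      and q_ortho: "\<And>j l. j \<in> J \<Longrightarrow> l \<in> odo_words n \<Longrightarrow> cinner (foldr opr l j) q = 0"
      by (auto simp: Q_def K_def)
    have W_killed: "adj (V k) (adj W x) = 0" if "\<And>k. k \<in> {1..n} \<Longrightarrow> adj (V k) x = 0" "k \<in> {1..n}" for k x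
    proof (cases "k = n")
      case True
      then show ?thesis
        using that(1)[OF n_mem(1)] by (simp add: adjV_n_adjW adj_zero[OF isoW])
    next
      case False
      then show ?thesis
        using that by (simp add: adjV_adjW)
    qed
    have killed_W: "adj (V k) (W x) = 0" if "\<And>k. k \<in> {1..n} \<Longrightarrow> adj (V k) x = 0" "k \<in> {1..n}" for k x
      using that(2)
    proof (cases rule: index_cases)
      case 1
      then show ?thesis
        using that(1)[OF n_mem(2)] by (simp add: adjV_1_W iso_zero[OF isoW])
    next
      case (2 j)
      then show ?thesis
        using that by (simp add: adjV_W)
    qed
    have "cinner (foldr opr l j) (adj W q) = 0" if "j \<in> J" "l \<in> odo_words n" for j l
      using q_ortho[of j "GenW # l"] that by (simp add: cinner_adj[OF isoW])
    then show "adj W q \<in> Q"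
      using W_killed[of q] q by (simp add: Q_def K_def shift_part_invariant)
    \<comment> \<open>This vector is killed by all adjoints and is orthogonal to \<open>J\<close>,
      because \<open>q\<close> is and \<open>adj W\<close> kills the elements of \<open>J\<close>;
      maximality of \<open>J\<close> forces it to be 0.\<close>
    have "q - W (adj W q) = 0"
    proof (rule max)
      show "q - W (adj W q) \<in> wandering"
        using q killed_W[of "adj W q"] W_killed[of q]
        by (simp add: wandering_def closed_csubspaceD(6)[OF shift_part_subspace] shift_part_invariant
            adj_diff[OF isoW] adj_iso[OF isoW] adj_diff[OF isom])
      fix j assume j: "j \<in> J"
      then have "adj W j = 0"
        using J by (auto simp: wandering_def)
      then have "cinner j (W (adj W q)) = 0"
        by (simp add: cinner_adj'[OF isoW])
      then show "cinner j (q - W (adj W q)) = 0"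
        using q_ortho[OF j, of "[]"] by (simp add: cinner_diff_right)
    qed
    then show "W (adj W q) = q"
      by simp
  qed
  then have Q_zero: "q = 0" if "q \<in> Q" for q
    using that orthocomp_Int_eq_0[of q w.core] by (auto simp: Q_def K_def shift_part_def)
  have "K \<subseteq> core"
  proof (rule subset_coreI)
    fix x assume "x \<in> K"
    then have x: "x \<in> shift_part"
      and x_ortho: "\<And>j l. j \<in> J \<Longrightarrow> l \<in> odo_words n \<Longrightarrow> cinner (foldr opr l j) x = 0"
      by (auto simp: K_def)
    show step: "adj (V k) x \<in> K" if k: "k \<in> {1..n}" for k
    proof -
      have "cinner (foldr opr l j) (adj (V k) x) = 0" if "j \<in> J" "l \<in> odo_words n" for j l
        using x_ortho[of j "GenV k # l"] that k by (simp add: cinner_adj[OF isom[OF k]])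
      then show ?thesis
        using x k by (simp add: K_def shift_part_invariant)
    qed
    have "x - row_proj x = 0"
    proof (rule Q_zero)
      have "row_proj x \<in> shift_part"
        unfolding row_proj_def using x by (intro closed_csubspace_sum shift_part_subspace shift_part_invariant)
      moreover have "adj (V k) (x - row_proj x) = 0" if "k \<in> {1..n}" for k
        using that by (simp add: adj_diff[OF isom] row_proj_def adj_row_sum)
      moreover have "cinner (foldr opr l j) (x - row_proj x) = 0"
        if j: "j \<in> J" and l: "l \<in> odo_words n" for j l
      proof -
        \<comment> \<open>In normal form, a word without letters \<open>v\<^sub>k\<close> gives a
          vector killed by \<open>row_proj\<close>; for a word with first letter
          \<open>v\<^sub>k\<close>, \<open>adj (V k)\<close> kills the defect.\<close>
        obtain \<mu> N where \<mu>: "set \<mu> \<subseteq> {1..n}" "odo_cong n l (odo_nf \<mu> N)"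
          using odo_normal_form[OF l] .
        note nf = opr_cong[OF \<mu>(2)]
        show ?thesis
        proof (cases \<mu>)
          case Nil
          have "cinner (foldr opr (odo_nf [] N) j) (row_proj x) = 0"
            unfolding cinner_row_proj[symmetric]
            using J j adjV_nf_Nil[of j _ N]
            by (auto simp: row_proj_def iso_zero[OF isom])
          then show ?thesis
            using x_ortho[OF j l] Nil by (simp add: cinner_diff_right nf)
        next
          case (Cons k \<nu>)
          then show ?thesis
            using \<mu>(1) by (simp add: nf cinner_adj[OF isom] adj_diff[OF isom] row_proj_def adj_row_sum)
        qed
      qed
      ultimately show "x - row_proj x \<in> Q"
        using x by (simp add: Q_def K_def closed_csubspaceD(6)[OF shift_part_subspace])
    qed
    then show "row_proj x = x"
      by simp
  qed
  moreover have "cinner (foldr opr l j) h = 0" if "j \<in> J" "l \<in> odo_words n" for j l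
    using ortho[of j "odo_class n l"] that by (simp add: odometer_carrier rep_class)
  then have "h \<in> K"
    using h by (simp add: K_def)
  ultimately show "h = 0"
    using h orthocomp_Int_eq_0[of h core] by (auto simp: shift_part_def)
qed

text \<open>A first letter \<open>k > 1\<close> is divisible by \<open>w\<close>, being
  \<open>w\<close> times the preceding letter. For first letter 1, divisibility of the rest passes
  on by the carry relation, and vanishing of \<open>adj W\<close> on the rest passes on by Nica
  covariance.\<close>

lemma adj_W_nf:
  assumes e: "e \<in> wandering"
  shows "set \<mu> \<subseteq> {1..n} \<Longrightarrow> (\<exists>l\<in>odo_words n. odo_cong n (GenW # l) (odo_nf \<mu> N)) \<or>
    adj W (foldr opr (odo_nf \<mu> N) e) = 0"
proof (induction \<mu>)
  case Nil
  show ?case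
  proof (cases N)
    case 0
    then show ?thesis
      using e by (simp add: wandering_def)
  next
    case (Suc M)
    have "odo_nf [] M \<in> odo_words n"
      by (simp add: odo_nf_words)
    then show ?thesis
      using Suc odo_cong.refl[of n "odo_nf [] N"] by auto
  qed
next
  case (Cons k \<mu>)
  from Cons.prems have k: "k \<in> {1..n}"
    by simp
  then show ?case
  proof (cases rule: index_cases)
    case 1
    consider l where "l \<in> odo_words n" "odo_cong n (GenW # l) (odo_nf \<mu> N)"
      | "adj W (foldr opr (odo_nf \<mu> N) e) = 0"
      using Cons by auto
    then show ?thesis
    proof cases
      case (1 l)
      have "odo_cong n (GenW # GenV n # l) (odo_nf (k # \<mu>) N)"
        using odo_cong.trans[OF odo_cong_GenW_GenV(2) odo_cong_Cons[OF 1(2)]] \<open>k = 1\<close> by simp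
      moreover have "GenV n # l \<in> odo_words n"
        using 1(1) n_mem(2) by simp
      ultimately show ?thesis
        by blast
    next
      case 2
      then show ?thesis
        using \<open>k = 1\<close> by (simp add: adjW_V_1 iso_zero[OF isom[OF n_mem(2)]])
    qed
  next
    case (2 j)
    then have "odo_cong n (GenW # GenV j # odo_nf \<mu> N) (odo_nf (k # \<mu>) N)"
      using odo_cong_GenW_GenV(1) by simp
    moreover have "GenV j # odo_nf \<mu> N \<in> odo_words n"
      using 2 Cons.prems by (simp add: odo_nf_words)
    ultimately show ?thesis
      by blast
  qed
qed

text \<open>Matches the zero coefficients of \<open>left_regular\<close> at elements that are not
  left multiples of \<open>g\<close>: their basis vectors are orthogonal to the range of
  \<open>opr g\<close>. For \<open>v\<^sub>k\<close> first letters are compared, for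
  \<open>w\<close> the claim is \<open>adj_W_nf\<close>.\<close>

lemma adj_opr_rep:
  assumes g: "[g] \<in> odo_words n" and y: "y \<in> carrier (odometer n)" and e: "e \<in> wandering"
    and not_mult: "\<And>x. x \<in> carrier (odometer n) \<Longrightarrow> odo_class n [g] \<otimes>\<^bsub>odometer n\<^esub> x \<noteq> y"
  shows "adj (opr g) (rep y e) = 0"
proof -
  obtain \<mu> N where \<mu>: "set \<mu> \<subseteq> {1..n}" and y_eq: "y = odo_class n (odo_nf \<mu> N)"
    using odo_carrier_normal_form[OF y] .
  have rep: "rep y e = foldr opr (odo_nf \<mu> N) e"
    using \<mu> by (simp add: y_eq rep_class odo_nf_words)
  have no_cong: "\<not> odo_cong n (g # l) (odo_nf \<mu> N)" if "l \<in> odo_words n" for l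
  proof
    assume "odo_cong n (g # l) (odo_nf \<mu> N)"
    then have "odo_class n [g] \<otimes>\<^bsub>odometer n\<^esub> odo_class n l = y"
      using that g by (simp add: odo_mult_class y_eq odo_class_eq)
    then show False
      using not_mult that by (auto simp: odometer_carrier)
  qed
  show ?thesis
  proof (cases g)
    case GenW
    then show ?thesis
      using adj_W_nf[OF e \<mu>, of N] no_cong rep by auto
  next
    case (GenV k)
    then have k: "k \<in> {1..n}"
      using g by simp
    show ?thesis
    proof (cases \<mu>)
      case Nil
      then show ?thesis
        using adjV_nf_Nil[OF e k] GenV rep by simp
    next
      case (Cons k' \<nu>)
      then have "k \<noteq> k'"
        using no_cong[of "odo_nf \<nu> N"] \<mu> GenV by (auto simp: odo_nf_words odo_cong.refl)
      then show ?thesis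
        using Cons \<mu> k GenV rep by (simp add: adj_row)
    qed
  qed
qed

lemma shift_part_multiple: "multiple_of_left_regular shift_part n W V"
proof -
  let ?X = "carrier (odometer n)"
  obtain J where J: "J \<subseteq> wandering" "orthonormal_on J (\<lambda>x. x)"
    and max: "\<And>x. x \<in> wandering \<Longrightarrow> (\<And>j. j \<in> J \<Longrightarrow> cinner j x = 0) \<Longrightarrow> x = 0"
    using exists_maximal_orthonormal[of wandering] wandering_scaleC by metis
  define U where "U = (\<lambda>h j x. if j \<in> J \<and> x \<in> ?X then cinner (rep x j) h else 0)"
  note on = orthonormal_rep[OF J]
  have "J \<subseteq> shift_part"
    using J(1) by (auto simp: wandering_def)
  then have "unitary_onto_copies shift_part J ?X (\<lambda>h j x. if j \<in> J \<and> x \<in> ?X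
      then cinner (case (j, x) of (j, x) \<Rightarrow> rep x j) h else 0)"
    using rep_total[OF J(1) max]
    by (intro unitary_onto_copies_basis[OF on shift_part_subspace]) (auto intro: rep_shift_part)
  then have unitary: "unitary_onto_copies shift_part J ?X U"
    by (simp only: U_def prod.case)
  \<comment> \<open>Coordinatewise: if \<open>y = g x\<close>, isometry of \<open>opr g\<close>
    moves the coefficient from \<open>x\<close> to \<open>y\<close>; if \<open>y\<close> is no left
    multiple of \<open>g\<close>, both sides are 0 by \<open>adj_opr_rep\<close>.\<close>
  have intertwine: "U (opr g h) = (\<lambda>j. left_regular (odometer n) (odo_class n [g]) (U h j))"
    if g: "[g] \<in> odo_words n" for g h
  proof (intro ext)
    fix j y
    let ?S = "{x \<in> ?X. odo_class n [g] \<otimes>\<^bsub>odometer n\<^esub> x = y}"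
    have "U (opr g h) j y = (\<Sum>\<^sub>\<infinity>x\<in>?S. U h j x)"
    proof (cases "j \<in> J")
      case False
      then show ?thesis
        by (simp add: U_def)
    next
      case j: True
      show ?thesis
      proof (cases "?S = {}")
        case True
        have "U (opr g h) j y = 0"
        proof (cases "y \<in> ?X")
          case y: True
          have "adj (opr g) (rep y j) = 0"
            using True J(1) j by (intro adj_opr_rep g y) auto
          then show ?thesis
            using y j by (simp add: U_def cinner_adj'[OF iso_opr[OF g]])
        qed (simp add: U_def)
        then show ?thesis
          by (simp only: True infsum_empty)
      next
        case False
        then obtain x where x: "x \<in> ?X" "odo_class n [g] \<otimes>\<^bsub>odometer n\<^esub> x = y"
          by blast
        \<comment> \<open>Left cancellation is read off from the representation:
          \<open>opr g\<close> is injective and distinct elements give orthogonal unit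
          vectors.\<close>
        have "x' = x" if x': "x' \<in> ?S" for x'
        proof (rule ccontr)
          assume "x' \<noteq> x"
          have "opr g (rep x j) = opr g (rep x' j)"
            using x x' rep_mult(1)[OF g, of x j] rep_mult(1)[OF g, of x' j] by simp
          then have "rep x j = rep x' j"
            by (metis adj_iso iso_opr[OF g])
          moreover have "cinner (rep x j) (rep x j) = 1" "cinner (rep x j) (rep x' j) = 0"
            using on j x x' \<open>x' \<noteq> x\<close> by (auto simp: orthonormal_on_def)
          ultimately show False
            by simp
        qed
        with x have "?S = {x}"
          by blast
        moreover have "U (opr g h) j y = U h j x"
          using rep_mult[OF g x(1)] x j iso_cinner[OF iso_opr[OF g]] by (auto simp: U_def)
        ultimately show ?thesis
          by simp
      qed
    qed
    then show "U (opr g h) j y = left_regular (odometer n) (odo_class n [g]) (U h j) y"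
      by (simp add: left_regular_def)
  qed
  show ?thesis
    unfolding multiple_of_left_regular_def odo_w_def odo_v_def
    using unitary intertwine[of GenW] intertwine[of "GenV k" for k]
    by (intro exI[of _ J] exI[of _ U]) (simp add: shift_part_invariant)
qed

text \<open>Through \<open>U\<close>, vectors in all iterated ranges get coefficients of arbitrarily
  high support, hence vanish; \<open>odo_affine\<close> measures powers of \<open>W\<close> and
  \<open>odo_degree\<close> the length of words in the \<open>V k\<close>.\<close>

lemma multiple_of_left_regular_pure:
  assumes red: "reduces M W" "\<And>k. k \<in> {1..n} \<Longrightarrow> reduces M (V k)"
    and mult: "multiple_of_left_regular M n W V"
  shows "M \<subseteq> orthocomp w.core" "M \<subseteq> orthocomp core"
proof -
  obtain J :: "'a set" and U where U: "unitary_onto_copies M J (carrier (odometer n)) U"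
    and UW: "\<And>h. h \<in> M \<Longrightarrow> U (W h) = (\<lambda>j. left_regular (odometer n) (odo_class n [GenW]) (U h j))"
    and UV: "\<And>k h. k \<in> {1..n} \<Longrightarrow> h \<in> M \<Longrightarrow>
      U (V k h) = (\<lambda>j. left_regular (odometer n) (odo_class n [GenV k]) (U h j))"
    using mult unfolding multiple_of_left_regular_def odo_w_def odo_v_def by blast
  have M: "closed_csubspace M"
    using red(1) by (simp add: reduces_def)
  note zero_mem = closed_csubspaceD(2)[OF M]
  interpret rV: reducing_subspace n V M
    by unfold_locales (use M red in auto)
  interpret rW: reducing_subspace 1 "\<lambda>_. W" M
    by (rule reducing_subspace_single[OF isoW red(1)])
  have U_add: "U (h + k) = (\<lambda>j x. U h j x + U k j x)" if "h \<in> M" "k \<in> M" for h k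
    using U that by (simp add: unitary_onto_copies_def)
  have "U (0 + 0) = (\<lambda>j x. U 0 j x + U 0 j x)"
    by (rule U_add[OF zero_mem zero_mem])
  then have U_0: "U 0 j x = 0" for j x
    by (simp add: fun_eq_iff)
  have U_sum: "U (\<Sum>k\<in>A. f k) = (\<lambda>j x. \<Sum>k\<in>A. U (f k) j x)" if "\<And>k. k \<in> A \<Longrightarrow> f k \<in> M" for f :: "nat \<Rightarrow> 'a" and A
    using that
  proof (induction A rule: infinite_finite_induct)
    case (insert a A)
    then show ?case
      by (simp add: U_add closed_csubspace_sum[OF M])
  qed (simp_all add: U_0 fun_eq_iff)
  have zero: "h = 0" if h: "h \<in> M" and high: "\<And>m j. high_support c m (U h j)" for c h
  proof -
    have Uh: "U h \<in> ell2_copies J (carrier (odometer n))"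
      using U h by (auto simp: unitary_onto_copies_def bij_betw_def)
    have "U h j x = 0" for j x
    proof (cases "j \<in> J")
      case True
      then have "U h j \<in> ell2 (carrier (odometer n))"
        using Uh by (simp add: ell2_copies_def)
      then show ?thesis
        using high by (rule all_high_support_imp_0)
    qed (use Uh in \<open>simp add: ell2_copies_def\<close>)
    then have "U h = U 0"
      by (simp add: U_0 fun_eq_iff)
    then show ?thesis
      using U h zero_mem by (auto simp: unitary_onto_copies_def bij_betw_def dest: inj_onD)
  qed
  have W_high: "high_support (\<lambda>l. foldr (odo_affine n) l 0) m (U h j)" if "h \<in> (W ^^ m) ` M" for m h j
    using that
  proof (induction m arbitrary: h j)
    case (Suc m)
    then obtain h' where h': "h' \<in> (W ^^ m) ` M" "h = W h'"
      by auto
    then have "h' \<in> M"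
      using rW.row_range_eq[of m] row_range_single[OF isoW, of M m] by blast
    then have "U h j = left_regular (odometer n) (odo_class n [GenW]) (U h' j)"
      by (simp add: h'(2) UW)
    moreover have "high_support (\<lambda>l. foldr (odo_affine n) l 0) (Suc m) \<dots>"
      by (intro high_support_left_regular Suc.IH h'(1))
        (auto simp: odo_cong_affine[OF n])
    ultimately show ?case
      by simp
  qed (simp add: high_support_def)
  have "h = 0" if h: "h \<in> (\<Inter>m. (W ^^ m) ` M)" for h
  proof (rule zero)
    show "h \<in> M"
      using INT_D[OF h, of 0] by simp
    show "high_support (\<lambda>l. foldr (odo_affine n) l 0) m (U h j)" for m j
      using INT_D[OF h, of m] by (intro W_high) simp
  qed
  moreover have "0 \<in> (W ^^ m) ` M" for m
    using row_range_single[OF isoW, of M m] rW.row_range_eq[of m] zero_mem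
      closed_csubspaceD(2)[OF w.closed_csubspace_row_range] by blast
  ultimately have "pure_isometry_on M W"
    using rW.row_isometry_on_M by (auto simp: pure_isometry_on_def row_isometry_on_def)
  then show "M \<subseteq> orthocomp w.core"
    by (simp add: pure_isometry_on_iff[OF isoW red(1)])
  have V_high: "high_support (\<lambda>l. foldr odo_degree l 0) m (U h j)" if "h \<in> row_range M n V m" for m h j
    using that
  proof (induction m arbitrary: h j)
    case (Suc m)
    then obtain y where y: "\<And>k. k \<in> {1..n} \<Longrightarrow> y k \<in> row_range M n V m"
      and h: "h = (\<Sum>k=1..n. V k (y k))"
      unfolding row_range_Suc by blast
    then have y_M: "y k \<in> M" if "k \<in> {1..n}" for k
      using that rV.row_range_eq[of m] by blast
    have "U h j = (\<lambda>x. \<Sum>k=1..n. U (V k (y k)) j x)"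
      unfolding h by (subst U_sum) (simp_all add: rV.invariant y_M)
    also have "\<dots> = (\<lambda>x. \<Sum>k=1..n. left_regular (odometer n) (odo_class n [GenV k]) (U (y k) j) x)"
      by (intro ext sum.cong HOL.refl) (simp add: UV y_M)
    finally have eq: "U h j =
      (\<lambda>x. \<Sum>k=1..n. left_regular (odometer n) (odo_class n [GenV k]) (U (y k) j) x)" .
    show ?case
      unfolding eq by (intro high_support_sum high_support_left_regular Suc.IH y)
        (auto simp: odo_cong_degree)
  qed (simp add: high_support_def)
  have "h = 0" if h: "h \<in> (\<Inter>m. row_range M n V m)" for h
  proof (rule zero)
    show "h \<in> M"
      using INT_D[OF h, of 0] by (simp add: row_range_0)
    show "high_support (\<lambda>l. foldr odo_degree l 0) m (U h j)" for m j
      using INT_D[OF h, of m] by (intro V_high) simp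
  qed
  moreover have "0 \<in> row_range M n V m" for m
    using rV.row_range_eq[of m] zero_mem closed_csubspaceD(2)[OF closed_csubspace_row_range] by blast
  ultimately have "pure_row_isometry_on M n V"
    using rV.row_isometry_on_M by (auto simp: pure_row_isometry_on_def)
  then show "M \<subseteq> orthocomp core"
    by (simp add: rV.pure_row_isometry_iff)
qed

end

section \<open>Orthogonal decompositions into four summands\<close>

lemma commuting_decomposition:
  assumes X: "closed_csubspace X" and Y: "closed_csubspace Y"
    and commute: "\<And>p q. p \<in> X \<Longrightarrow> q \<in> orthocomp X \<Longrightarrow> p + q \<in> Y \<Longrightarrow> p \<in> Y"
  shows "orthogonal_decomposition (X \<inter> Y) (X \<inter> orthocomp Y) (orthocomp X \<inter> Y)
    (orthocomp X \<inter> orthocomp Y)"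
proof -
  have "\<exists>a\<in>X \<inter> Y. \<exists>b\<in>X \<inter> orthocomp Y. \<exists>c\<in>orthocomp X \<inter> Y. \<exists>d\<in>orthocomp X \<inter> orthocomp Y.
      h = a + b + c + d" for h
  proof -
    \<comment> \<open>Split along \<open>Y\<close> first, then both parts along \<open>X\<close>.
      The hypothesis \<open>commute\<close> says that the projection onto \<open>X\<close> preserves
      \<open>Y\<close>, so \<open>a\<close> and hence \<open>c\<close> remain in
      \<open>Y\<close>.\<close>
    obtain y z where y: "y \<in> Y" and z: "z \<in> orthocomp Y" and h: "h = y + z"
      using orthogonal_projection[OF Y] .
    obtain a c where ac: "a \<in> X" "c \<in> orthocomp X" "y = a + c"
      using orthogonal_projection[OF X] .
    obtain b d where bd: "b \<in> X" "d \<in> orthocomp X" "z = b + d"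
      using orthogonal_projection[OF X] .
    have a: "a \<in> Y"
      using ac y commute by blast
    then have c: "c \<in> Y"
      using closed_csubspaceD(6)[OF Y y a] ac by simp
    \<comment> \<open>Self-adjointness of the projection onto \<open>X\<close>:
      \<open>cinner u b\<close> equals \<open>cinner u1 z\<close>, which is 0 since
      \<open>u1\<close> is again in \<open>Y\<close>.\<close>
    have "cinner u b = 0" if "u \<in> Y" for u
    proof -
      obtain u1 u2 where u: "u1 \<in> X" "u2 \<in> orthocomp X" "u = u1 + u2"
        using orthogonal_projection[OF X] .
      then have "u1 \<in> Y"
        using that commute by blast
      then have "cinner u1 (b + d) = 0"
        using z bd by (simp add: orthocomp_cinner)
      then show ?thesis
        using u bd by (simp add: cinner_add_right cinner_add_left orthocomp_cinner orthocomp_cinner')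
    qed
    then have b: "b \<in> orthocomp Y"
      by (simp add: orthocomp_def)
    then have d: "d \<in> orthocomp Y"
      using closed_csubspaceD(6)[OF closed_csubspace_orthocomp z b] bd by simp
    have "h = a + b + c + d"
      by (simp add: h ac bd)
    with a b c d ac bd show ?thesis
      by blast
  qed
  then show ?thesis
    using X Y unfolding orthogonal_decomposition_def
    by (auto simp: closed_csubspace_Int closed_csubspace_orthocomp orthocomp_cinner orthocomp_cinner')
qed

text \<open>Components in the primed summands are also components in the larger ones, where
  orthogonality makes them unique; so every vector of \<open>A\<close> already lies in
  \<open>A'\<close>, and likewise for the others.\<close>

lemma orthogonal_decomposition_unique:
  assumes "orthogonal_decomposition A B C D" "orthogonal_decomposition A' B' C' D'"
    and "A' \<subseteq> A" "B' \<subseteq> B" "C' \<subseteq> C" "D' \<subseteq> D"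
  shows "(A', B', C', D') = (A, B, C, D)"
proof -
  have AD: "closed_csubspace A" "closed_csubspace B" "closed_csubspace C" "closed_csubspace D"
    using assms(1) by (simp_all add: orthogonal_decomposition_def)
  have ortho: "cinner a b = 0" "cinner a c = 0" "cinner a d = 0" "cinner b c = 0" "cinner b d = 0"
    "cinner c d = 0" if "a \<in> A" "b \<in> B" "c \<in> C" "d \<in> D" for a b c d
    using assms(1) that unfolding orthogonal_decomposition_def by blast+
  have zero_mem: "0 \<in> A" "0 \<in> B" "0 \<in> C" "0 \<in> D"
    using AD closed_csubspaceD(2) by blast+
  have independent: "a = 0 \<and> b = 0 \<and> c = 0 \<and> d = 0"
    if mem: "a \<in> A" "b \<in> B" "c \<in> C" "d \<in> D" and eq: "a + b + c + d = 0" for a b c d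
  proof -
    have o: "cinner a b = 0" "cinner a c = 0" "cinner a d = 0" "cinner b c = 0" "cinner b d = 0"
      "cinner c d = 0" "cinner b a = 0" "cinner c a = 0" "cinner d a = 0" "cinner c b = 0"
      "cinner d b = 0" "cinner d c = 0"
      using ortho[OF mem] by (simp_all add: cinner_eq_0_commute[of b a] cinner_eq_0_commute[of c a]
          cinner_eq_0_commute[of d a] cinner_eq_0_commute[of c b] cinner_eq_0_commute[of d b]
          cinner_eq_0_commute[of d c])
    have "cinner x (a + b + c + d) = 0" for x
      by (simp add: eq)
    from this[of a] this[of b] this[of c] this[of d] show ?thesis
      by (simp add: cinner_add_right o)
  qed
  have mem: "a \<in> A' \<and> b \<in> B' \<and> c \<in> C' \<and> d \<in> D'"
    if abcd: "a \<in> A" "b \<in> B" "c \<in> C" "d \<in> D" for a b c d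
  proof -
    obtain a' b' c' d' where m: "a' \<in> A'" "b' \<in> B'" "c' \<in> C'" "d' \<in> D'"
      and eq: "a + b + c + d = a' + b' + c' + d'"
      using assms(2) unfolding orthogonal_decomposition_def by blast
    have "a - a' \<in> A" "b - b' \<in> B" "c - c' \<in> C" "d - d' \<in> D"
      using AD abcd m assms(3-6) closed_csubspaceD(6) by blast+
    moreover have "(a - a') + (b - b') + (c - c') + (d - d') = 0"
      using eq by (simp add: algebra_simps)
    ultimately have "a - a' = 0 \<and> b - b' = 0 \<and> c - c' = 0 \<and> d - d' = 0"
      by (rule independent)
    with m show ?thesis
      by simp
  qed
  have "A \<subseteq> A'" "B \<subseteq> B'" "C \<subseteq> C'" "D \<subseteq> D'"
    using mem zero_mem by blast+
  with assms(3-6) show ?thesis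
    by blast
qed

theorem theorem4p4:
  fixes n :: nat
    and W :: "'a::chilbert_space \<Rightarrow> 'a"
    and V :: "nat \<Rightarrow> 'a \<Rightarrow> 'a"
  assumes "n \<ge> 1"
    and "odometer_isometric_rep n W V"
    and "nica_covariant n W V"
  shows "\<exists>!(\<H> :: 'a set \<times> 'a set \<times> 'a set \<times> 'a set). case \<H> of (Huu, Hus, Hsu, Hss) \<Rightarrow>
    orthogonal_decomposition Huu Hus Hsu Hss \<and>
    (\<forall>M\<in>{Huu, Hus, Hsu, Hss}. reduces M W \<and> (\<forall>i\<in>{1..n}. reduces M (V i))) \<and>
    (unitary_on Huu W \<and> row_unitary_on Huu n V) \<and>
    (unitary_on Hus W \<and> pure_row_isometry_on Hus n V) \<and>
    (pure_isometry_on Hsu W \<and> row_unitary_on Hsu n V) \<and>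
    multiple_of_left_regular Hss n W V"
proof -
  interpret odometer_rep n V W
    using assms
    by unfold_locales
      (auto simp: odometer_isometric_rep_def nica_covariant_def fun_eq_iff)
  have subspaces: "closed_csubspace w.core" "closed_csubspace core"
    by (rule w.closed_csubspace_core closed_csubspace_core)+
  \<comment> \<open>As \<open>w.core\<close> reduces the row \<open>V\<close>,
    \<open>projection_mem_core\<close> supplies the hypothesis \<open>commute\<close> with
    \<open>X = w.core\<close> and \<open>Y = core\<close>.\<close>
  interpret r: reducing_subspace n V w.core
    by unfold_locales (simp_all add: subspaces reduces_w_core_V)
  let ?Huu = "w.core \<inter> core" and ?Hus = "w.core \<inter> orthocomp core"
    and ?Hsu = "orthocomp w.core \<inter> core"
  have decomp: "orthogonal_decomposition ?Huu ?Hus ?Hsu shift_part"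
    unfolding shift_part_def by (rule commuting_decomposition[OF subspaces r.projection_mem_core])
  have red: "reduces M W \<and> (\<forall>i\<in>{1..n}. reduces M (V i))" if "M \<in> {?Huu, ?Hus, ?Hsu, shift_part}" for M
    using that reduces_shift_part
    by (auto simp: reduces_Int reduces_orthocomp isoW isom reduces_core_W
        reduces_w_core_W reduces_w_core_V reduces_core)
  have row: "row_unitary_on M n V \<longleftrightarrow> M \<subseteq> core" "pure_row_isometry_on M n V \<longleftrightarrow> M \<subseteq> orthocomp core"
    if "reduces M W \<and> (\<forall>i\<in>{1..n}. reduces M (V i))" for M
  proof -
    interpret M: reducing_subspace n V M
      using that by unfold_locales (auto simp: reduces_def)
    show "row_unitary_on M n V \<longleftrightarrow> M \<subseteq> core" "pure_row_isometry_on M n V \<longleftrightarrow> M \<subseteq> orthocomp core"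
      by (rule M.row_unitary_iff M.pure_row_isometry_iff)+
  qed
  note W_iff = unitary_on_iff[OF isoW] pure_isometry_on_iff[OF isoW]
  show ?thesis
  proof (rule ex1I[of _ "(?Huu, ?Hus, ?Hsu, shift_part)"])
    show "case (?Huu, ?Hus, ?Hsu, shift_part) of (Huu, Hus, Hsu, Hss) \<Rightarrow>
      orthogonal_decomposition Huu Hus Hsu Hss \<and>
      (\<forall>M\<in>{Huu, Hus, Hsu, Hss}. reduces M W \<and> (\<forall>i\<in>{1..n}. reduces M (V i))) \<and>
      (unitary_on Huu W \<and> row_unitary_on Huu n V) \<and>
      (unitary_on Hus W \<and> pure_row_isometry_on Hus n V) \<and>
      (pure_isometry_on Hsu W \<and> row_unitary_on Hsu n V) \<and>
      multiple_of_left_regular Hss n W V"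
      unfolding prod.case using red
      by (intro conjI ballI decomp shift_part_multiple) (simp_all add: row W_iff)
  next
    fix \<H> :: "'a set \<times> 'a set \<times> 'a set \<times> 'a set"
    obtain A B C D where \<H>: "\<H> = (A, B, C, D)"
      by (cases \<H>)
    assume "case \<H> of (Huu, Hus, Hsu, Hss) \<Rightarrow>
      orthogonal_decomposition Huu Hus Hsu Hss \<and>
      (\<forall>M\<in>{Huu, Hus, Hsu, Hss}. reduces M W \<and> (\<forall>i\<in>{1..n}. reduces M (V i))) \<and>
      (unitary_on Huu W \<and> row_unitary_on Huu n V) \<and>
      (unitary_on Hus W \<and> pure_row_isometry_on Hus n V) \<and>
      (pure_isometry_on Hsu W \<and> row_unitary_on Hsu n V) \<and>
      multiple_of_left_regular Hss n W V"
    then have H: "orthogonal_decomposition A B C D"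
      "\<And>M. M \<in> {A, B, C, D} \<Longrightarrow> reduces M W \<and> (\<forall>i\<in>{1..n}. reduces M (V i))"
      "unitary_on A W" "row_unitary_on A n V" "unitary_on B W" "pure_row_isometry_on B n V"
      "pure_isometry_on C W" "row_unitary_on C n V" "multiple_of_left_regular D n W V"
      unfolding \<H> prod.case by blast+
    \<comment> \<open>Each property required of a summand yields containment in a core or in its
      complement, so the given summands lie termwise in the constructed ones.\<close>
    have "D \<subseteq> shift_part"
      using multiple_of_left_regular_pure[OF _ _ H(9)] H(2)[of D] unfolding shift_part_def by blast
    moreover have "A \<subseteq> ?Huu" "B \<subseteq> ?Hus" "C \<subseteq> ?Hsu"
      using H(2)[of A] H(2)[of B] H(2)[of C] H(3-8) by (simp_all add: row W_iff)
    ultimately show "\<H> = (?Huu, ?Hus, ?Hsu, shift_part)"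
      unfolding \<H> by (intro orthogonal_decomposition_unique[OF decomp H(1)])
  qed
qed

end
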